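(* Let $c>0$. Then the set of positive integers $n$ satisfying $$f(n) > \log_3 n - \log(1/c)$$ has asymptotic density $1-e^{-1/c}$. In particular, for any function $\xi:\mathbb{N}\to\mathbb{R}$ with $\xi(n)\to\infty$ as $n\to\infty$, the inequalities $$\log_3 n - \xi(n) \le f(n) \le \log_3 n + \xi(n)$$ hold for almost all integers $n$, i.e. on a set of integers of asymptotic density $1$.
   Context: For a positive integer $n$, let $\omega(n)$ be the number of distinct prime factors of $n$, and let $p_1(n)<p_2(n)<\dots<p_{\omega(n)}(n)$ be the increasing sequence of distinct prime factors of $n$. Define $$f(n) := \max_{1\le j<\omega(n)} \log\!\left(\frac{\log p_{j+1}(n)}{\log p_j(n)}\right)$$ for $n$ with $\omega(n)\ge 2$ (the value assigned when $\omega(n)\le 1$ is immaterial for density statements, since such integers have asymptotic density zero). Here $\log_k$ denotes the $k$-fold iterated natural logarithm, so $\log_3 n=\log\log\log n$ (defined for $n$ sufficiently large). A set $A$ of positive integers has asymptotic density $\delta$ if $|\{n\le x: n\in A\}|/x\to\delta$ as $x\to\infty$. *)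

theory Defs
  imports Complex_Main "HOL-Computational_Algebra.Primes"
begin

definition omega :: "nat \<Rightarrow> nat" where
  "omega n = card (prime_factors n)"

text \<open>The index \<open>j\<close> is 1-based: \<open>nth_prime_factor n 1 < \<dots> < nth_prime_factor n (omega n)\<close> are the
  distinct prime factors of \<open>n\<close>; the value is irrelevant for other \<open>j\<close>.\<close>

definition nth_prime_factor :: "nat \<Rightarrow> nat \<Rightarrow> nat" where
  "nth_prime_factor n j = sorted_list_of_set (prime_factors n) ! (j - 1)"

text \<open>The value \<open>0\<close> for \<open>omega n \<le> 1\<close> is an arbitrary convention.\<close>

definition max_log_gap :: "nat \<Rightarrow> real" where
  "max_log_gap n =
     (if omega n \<ge> 2
      then Max ((\<lambda>j. ln (ln (real (nth_prime_factor n (j + 1))) / ln (real (nth_prime_factor n j))))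
                  ` {1..<omega n})
      else 0)"

text \<open>For the finitely many integers whose \<open>k\<close>-fold logarithm is undefined, the value
  is whatever the total function \<open>ln\<close> yields; this does not affect densities.\<close>

definition iter_ln :: "nat \<Rightarrow> real \<Rightarrow> real" where
  "iter_ln k x = (ln ^^ k) x"

definition has_asymptotic_density :: "nat set \<Rightarrow> real \<Rightarrow> bool" where
  "has_asymptotic_density A \<delta> \<longleftrightarrow>
     ((\<lambda>x::real. real (card {n \<in> A. 1 \<le> n \<and> real n \<le> x}) / x) \<longlongrightarrow> \<delta>) at_top"

end

theory Submission
  imports Defs "HOL-Number_Theory.Prime_Powers" "HOL-Real_Asymp.Real_Asymp"
begin

text \<open>
  Write \<open>T = ln (ln n)\<close>. The inequality says that some prime factor \<open>p\<close> of \<open>n\<close> is followed by no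
  prime factor up to \<open>p ^ (c T)\<close> but by a larger one. If the events \<open>p dvd n\<close> were independent with
  probabilities \<open>1 / p\<close>, such a gap would open at \<open>p\<close> with probability about \<open>1 / (p c T)\<close>
  by Mertens' theorem, and these probabilities sum to \<open>1 / c\<close>. Gaps are almost independent of each
  other: the probability \<open>F p\<close> that none opens up to \<open>p\<close> satisfies a recursion of the shape
  \<open>F p = (1 - 1 / (p c T)) * F (p - 1)\<close> up to small errors, whence the limit \<open>exp (- 1 / c)\<close>.

  The model is compared with the integers up to \<open>N\<close> in total variation by Brun's sieve (Bonferroni's
  inequalities with Rankin's trick), for primes up to \<open>N\<close> to a power of order \<open>1 / T\<^sup>2\<close>. Gaps at larger
  primes are rare, because by Turan's second moment argument few integers avoid all primes in \<open>(u, v]\<close>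
  when \<open>ln (ln v) - ln (ln u)\<close> is large.
\<close>

section \<open>Mertens' estimates\<close>

text \<open>The event that some gap opens up to a given point is a union of many dependent events,
  so integers and model cannot be compared gap by gap; the sieve compares the whole distribution of
  the set of small prime factors, which serves every event at once. A gap in the model need not be
  closed by a larger prime: it then depends only on the primes from \<open>p\<close> to
  \<open>p ^ K\<close>, which gives the independence behind the recursion, while integers without
  prime factors beyond the cutoff are rare. The exponent \<open>c T\<close> varies with
  \<open>n\<close>, but between \<open>sqrt N\<close> and \<open>N\<close> the value of
  \<open>ln (ln n)\<close> changes by at most \<open>ln 2\<close>; one integer exponent
  \<open>K\<close> per \<open>N\<close> suffices, rounded down for the upper bound and up for the
  lower one. Below any fixed bound, where Mertens' theorem is imprecise, the primes have total gap
  probability \<open>O(1 / K)\<close> and do not affect the limit.\<close>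

definition primes_in :: "nat \<Rightarrow> nat \<Rightarrow> nat set" where
  "primes_in u v = {p. prime p \<and> u < p \<and> p \<le> v}"

lemma finite_primes_in [simp]: "finite (primes_in u v)"
  by (rule finite_subset[of _ "{..v}"]) (auto simp: primes_in_def)

lemma primes_inD: "p \<in> primes_in u v \<Longrightarrow> prime p" "p \<in> primes_in u v \<Longrightarrow> u < p"
    "p \<in> primes_in u v \<Longrightarrow> p \<le> v"
  by (auto simp: primes_in_def)

lemma primes_in_ge2: "p \<in> primes_in u v \<Longrightarrow> 2 \<le> p"
  using prime_ge_2_nat by (auto simp: primes_in_def)

lemma real_div_ge: "real n / real d - 1 \<le> real (n div d)"
  using floor_divide_of_nat_eq[of n d, where ?'a = real] by linarith

lemma prod_primes_dvd:
  assumes "finite A" "\<And>p. p \<in> A \<Longrightarrow> prime (p::nat)" "\<And>p. p \<in> A \<Longrightarrow> p dvd m"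
  shows "\<Prod>A dvd m"
  using assms
proof (induction A rule: finite_induct)
  case (insert p A)
  have "coprime p (\<Prod>A)"
    using insert by (intro prod_coprime_right) (metis insertCI primes_coprime)
  with insert show ?case by (simp add: divides_mult)
qed auto

section \<open>Chebyshev's upper bound for the product of the primes\<close>

lemma primes_in_split: "u \<le> v \<Longrightarrow> v \<le> w \<Longrightarrow> primes_in u w = primes_in u v \<union> primes_in v w"
  by (auto simp: primes_in_def)

lemma primes_in_0_Suc: "primes_in 0 (Suc n) = (if prime (Suc n) then insert (Suc n) (primes_in 0 n) else primes_in 0 n)"
  by (auto simp: primes_in_def le_Suc_eq)

text \<open>Erdos' argument: for \<open>n = 2 * m + 1\<close> every prime in (m + 1, n] divides
  \<open>n choose m\<close>, which is at most \<open>4 ^ m\<close> because the lower half of row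
  \<open>n\<close> of Pascal's triangle sums to \<open>4 ^ m\<close>.\<close>

lemma prod_primes_in_le: "\<Prod>(primes_in 0 n) \<le> 4 ^ n"
proof (induction n rule: less_induct)
  case (less n)
  consider "n \<le> 2" | "n > 2" "even n" | m where "n = 2 * m + 1" "m \<ge> 1"
  proof (cases "n \<le> 2 \<or> even n")
    case False
    then obtain m where "n = 2 * m + 1" by (auto elim!: oddE)
    with False that(3) show ?thesis by auto
  qed (use that in force)
  then show ?case
  proof cases
    case 1
    have "primes_in 0 n \<subseteq> {2}"
      using 1 primes_in_ge2[of _ 0 n] primes_inD(3)[of _ 0 n] by fastforce
    then have "primes_in 0 n = {} \<or> (primes_in 0 n = {2} \<and> n = 2)"
      using 1 primes_inD(3)[of 2 0 n] by auto
    then show ?thesis by auto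
  next
    case 2
    then have "\<not> prime n" using prime_odd_nat by blast
    moreover obtain k where "n = Suc k" using 2 by (cases n) auto
    ultimately have "primes_in 0 n = primes_in 0 k" by (simp add: primes_in_0_Suc)
    moreover have "(4::nat) ^ k \<le> 4 ^ n" using \<open>n = Suc k\<close> by simp
    ultimately show ?thesis using less.IH[of k] \<open>n = Suc k\<close> by simp
  next
    case (3 m)
    have "\<Prod>(primes_in (m+1) n) dvd (n choose m)"
    proof (rule prod_primes_dvd)
      fix p assume p: "p \<in> primes_in (m+1) n"
      then have pr: "prime p" and "m + 1 < p" "p \<le> n" by (auto simp: primes_in_def)
      have "fact m * fact (n - m) * (n choose m) = (fact n :: nat)"
        using 3 by (intro binomial_fact_lemma) auto
      moreover have "p dvd (fact n :: nat)" using pr \<open>p \<le> n\<close> by (simp add: prime_dvd_fact_iff)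
      moreover have "\<not> p dvd (fact m :: nat)" "\<not> p dvd (fact (n-m) :: nat)"
        using pr \<open>m+1 < p\<close> 3 by (auto simp: prime_dvd_fact_iff simp del: fact_Suc)
      ultimately show "p dvd (n choose m)" using pr by (metis prime_dvd_mult_iff)
    qed (auto simp: primes_in_def)
    moreover have "n choose m \<le> 4 ^ m"
    proof -
      have "(n choose m) \<le> (\<Sum>k\<le>m. (2 * m + 1 choose k))"
        unfolding 3 by (rule member_le_sum) auto
      also have "\<dots> = 4 ^ m" by (subst binomial_r_part_sum) (simp add: power_mult)
      finally show ?thesis .
    qed
    moreover have "n choose m > 0" using 3 by auto
    ultimately have le: "\<Prod>(primes_in (m+1) n) \<le> 4 ^ m" by (meson dvd_imp_le le_trans)
    have "\<Prod>(primes_in 0 n) = \<Prod>(primes_in 0 (m+1)) * \<Prod>(primes_in (m+1) n)"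
      using 3 by (subst primes_in_split[of 0 "m+1" n])
        (auto intro!: prod.union_disjoint simp: primes_in_def)
    also have "\<dots> \<le> 4 ^ (m+1) * 4 ^ m"
      using less.IH[of "m+1"] 3 le by (intro mult_mono) auto
    also have "\<dots> = 4 ^ n" by (simp add: 3 flip: power_add mult_2)
    finally show ?thesis .
  qed
qed

lemma sum_ln_primes_le: "(\<Sum>p\<in>primes_in 0 n. ln (real p)) \<le> n * ln 4"
proof -
  have "(\<Sum>p\<in>primes_in 0 n. ln (real p)) = ln (\<Prod>p\<in>primes_in 0 n. real p)"
    by (subst ln_prod) (auto simp: primes_in_def)
  also have "(\<Prod>p\<in>primes_in 0 n. real p) = real (\<Prod>(primes_in 0 n))" by simp
  also have "ln (real (\<Prod>(primes_in 0 n))) \<le> ln (real (4 ^ n))"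
  proof (rule ln_mono)
    show "real (\<Prod>(primes_in 0 n)) \<le> real (4 ^ n)"
      using prod_primes_in_le[of n] of_nat_le_iff by blast
    have "0 < \<Prod>(primes_in 0 n)" by (rule prod_pos) (auto simp: primes_in_def)
    then show "0 < real (\<Prod>(primes_in 0 n))" by linarith
  qed
  also have "\<dots> = n * ln 4" by (simp add: ln_realpow)
  finally show ?thesis .
qed

section \<open>Mertens' first estimate, from the factorization of n!\<close>

lemma card_multiples:
  assumes "d > 0"
  shows "card {m\<in>{1..n}. d dvd m} = n div d"
proof -
  have "{m\<in>{1..n}. d dvd m} = (\<lambda>k. d * k) ` {1..n div d}"
    using assms by (auto simp: image_iff div_le_mono less_eq_div_iff_mult_less_eq mult.commute elim!: dvdE)
  moreover have "inj_on (\<lambda>k. d * k) {1..n div d}" using assms by (auto simp: inj_on_def)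
  ultimately show ?thesis by (simp add: card_image)
qed

lemma sum_divisors_upto:
  fixes g :: "nat \<Rightarrow> real"
  shows "(\<Sum>m=1..n. \<Sum>d | d dvd m. g d) = (\<Sum>d=1..n. g d * real (n div d))"
proof -
  have "(\<Sum>m=1..n. \<Sum>d | d dvd m. g d) = (\<Sum>m=1..n. \<Sum>d | d \<in> {1..n} \<and> d dvd m. g d)"
  proof (intro sum.cong refl)
    fix m assume m: "m \<in> {1..n}"
    then show "{d. d dvd m} = {d. d \<in> {1..n} \<and> d dvd m}"
      using dvd_imp_le[of _ m] by (auto simp: Suc_le_eq intro!: Nat.gr0I) (meson le_trans)
  qed
  also have "\<dots> = (\<Sum>d=1..n. \<Sum>m | m \<in> {1..n} \<and> d dvd m. g d)"
    by (rule sum.swap_restrict) auto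
  also have "\<dots> = (\<Sum>d=1..n. g d * real (n div d))"
  proof (intro sum.cong refl)
    fix d assume d: "d \<in> {1..n}"
    then have "card {m. m \<in> {1..n} \<and> d dvd m} = n div d" using card_multiples[of d n] by simp
    then show "(\<Sum>m | m \<in> {1..n} \<and> d dvd m. g d) = g d * real (n div d)"
      by (simp del: atLeastAtMost_iff)
  qed
  finally show ?thesis .
qed

lemma ln_fact_mangoldt: "ln (fact n) = (\<Sum>d=1..n. mangoldt d * real (n div d))"
proof -
  have "ln (fact n :: real) = (\<Sum>m=1..n. ln (real m))"
    by (induction n) (auto simp: ln_mult)
  also have "\<dots> = (\<Sum>m=1..n. \<Sum>d | d dvd m. mangoldt d)"
    using mangoldt_sum[where ?'a = real] by (intro sum.cong) auto
  also have "\<dots> = (\<Sum>d=1..n. mangoldt d * real (n div d))" by (rule sum_divisors_upto)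
  finally show ?thesis .
qed

lemma ln_fact_le: "ln (fact n :: real) \<le> n * ln n"
proof (cases "n = 0")
  case False
  have "ln (fact n :: real) \<le> ln (real (n ^ n))"
    using fact_le_power[of n] False by (intro ln_mono) auto
  with False show ?thesis by (simp add: ln_realpow)
qed auto

text \<open>Weak Stirling bound: \<open>n ^ n / fact n\<close> is a single term of the exponential
  series at \<open>n\<close>.\<close>

lemma ln_fact_ge: "n * ln n - n \<le> ln (fact n :: real)"
proof (cases "n = 0")
  case False
  have "real n ^ n / fact n \<le> exp (real n)"
  proof -
    have s: "(\<lambda>k. real n ^ k / fact k) sums exp (real n)"
      using exp_converges[of "real n"] by (simp add: field_simps scaleR_conv_of_real)
    have "(\<Sum>k\<in>{n}. real n ^ k / fact k) \<le> (\<Sum>k. real n ^ k / fact k)"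
      by (rule sum_le_suminf) (use s in \<open>auto simp: sums_iff\<close>)
    with s show ?thesis by (simp add: sums_iff)
  qed
  then have "ln (real n ^ n / fact n) \<le> n"
    using False ln_mono[of "real n ^ n / fact n" "exp (real n)"] by simp
  with False show ?thesis by (simp add: ln_div ln_realpow)
qed auto

definition prime_log_sum :: "nat \<Rightarrow> real" where
  "prime_log_sum n = (\<Sum>p\<in>primes_in 0 n. ln (real p) / real p)"

text \<open>Only the primes are kept in the expansion of \<open>ln (fact n)\<close>. Replacing
  \<open>n div p\<close> by \<open>n / p - 1\<close> costs the sum of \<open>ln p\<close>, which
  Chebyshev's bound limits to \<open>n * ln 4\<close>.\<close>

lemma prime_log_sum_le:
  assumes "n > 0"
  shows "prime_log_sum n \<le> ln n + ln 4"
proof -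
  have "n * prime_log_sum n - n * ln 4 \<le> n * prime_log_sum n - (\<Sum>p\<in>primes_in 0 n. ln (real p))"
    using sum_ln_primes_le[of n] by simp
  also have "\<dots> = (\<Sum>p\<in>primes_in 0 n. ln (real p) * (n / p - 1))"
    by (simp add: prime_log_sum_def sum_distrib_left sum_subtractf algebra_simps)
  also have "\<dots> \<le> (\<Sum>p\<in>primes_in 0 n. ln (real p) * real (n div p))"
  proof (intro sum_mono mult_left_mono)
    fix p assume "p \<in> primes_in 0 n"
    then show "real n / real p - 1 \<le> real (n div p)" "0 \<le> ln (real p)"
      using real_div_ge[of n p] primes_in_ge2[of p 0 n] by auto
  qed
  also have "\<dots> = (\<Sum>d\<in>primes_in 0 n. mangoldt d * real (n div d))"
    by (intro sum.cong) (auto simp: primes_in_def)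
  also have "\<dots> \<le> (\<Sum>d=1..n. mangoldt d * real (n div d))"
    by (rule sum_mono2) (auto simp: primes_in_def mangoldt_nonneg)
  also have "\<dots> = ln (fact n)" by (simp add: ln_fact_mangoldt)
  also have "\<dots> \<le> n * ln n" by (rule ln_fact_le)
  finally have "n * prime_log_sum n \<le> n * (ln n + ln 4)" by (simp add: algebra_simps)
  with assms show ?thesis by simp
qed

text \<open>Comparison with a telescoping series whose sum from \<open>m = 2\<close> is at most 4.
  The square root absorbs the logarithm through \<open>ln m <= 2 * sqrt (m - 1)\<close>. It serves
  to bound the contribution of the proper prime powers, where \<open>1 / (p - 1)\<close> replaces
  \<open>1 / p\<close>.\<close>

lemma ln_div_mult_pred_le:
  assumes "m \<ge> (2::nat)"
  shows "ln m / (m * (real m - 1)) \<le> 4 * (1 / sqrt (real m - 1) - 1 / sqrt m)"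
proof -
  define s t where "s = sqrt (real m)" and "t = sqrt (real m - 1)"
  have m: "real m = s\<^sup>2" "real m - 1 = t\<^sup>2" using assms by (auto simp: s_def t_def)
  have t: "t \<ge> 1" "s > t" "s > 1" using assms by (auto simp: s_def t_def)
  have s2: "s\<^sup>2 = t\<^sup>2 + 1" using m by simp
  have "s\<^sup>2 \<le> (t + 1)\<^sup>2" using s2 t by (simp add: power2_eq_square algebra_simps)
  then have "s \<le> t + 1" using t by (intro power2_le_imp_le[of s "t + 1"]) auto
  then have "s - 1 \<le> t" by simp
  have "ln (real m) = 2 * ln s" using t by (simp add: m ln_realpow)
  also have "\<dots> \<le> 2 * t" using ln_le_minus_one[of s] t \<open>s - 1 \<le> t\<close> by simp
  finally have l: "ln (real m) \<le> 2 * t" .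
  have "s - t = 1 / (s + t)" using s2 t by (simp add: field_simps power2_eq_square)
  moreover have "1 / (s + t) \<ge> 1 / (2 * s)" using t by (intro divide_left_mono) auto
  ultimately have st: "s - t \<ge> 1 / (2 * s)" by simp
  have "ln (real m) / (m * (real m - 1)) \<le> 2 * t / (s\<^sup>2 * t\<^sup>2)"
    unfolding m(2) using l t by (simp add: m divide_right_mono)
  also have "\<dots> = 4 * (1 / (2 * s)) / (s * t)" using t by (simp add: field_simps power2_eq_square)
  also have "\<dots> \<le> 4 * (s - t) / (s * t)" using st t by (intro divide_right_mono mult_left_mono) auto
  also have "\<dots> = 4 * (1 / t - 1 / s)" using t by (simp add: field_simps)
  finally show ?thesis by (simp add: s_def t_def)
qed

lemma prime_log_tail_le: "(\<Sum>p\<in>primes_in 0 n. ln p / (p * (real p - 1))) \<le> 4"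
proof -
  have pos: "0 \<le> 1 / sqrt (real m - 1) - 1 / sqrt m" if "m \<ge> 2" for m :: nat
    using that by (simp add: frac_le)
  have "(\<Sum>p\<in>primes_in 0 n. ln p / (p * (real p - 1)))
      \<le> (\<Sum>p\<in>primes_in 0 n. 4 * (1 / sqrt (real p - 1) - 1 / sqrt p))"
    by (intro sum_mono ln_div_mult_pred_le) (auto dest: primes_in_ge2)
  also have "\<dots> \<le> (\<Sum>m\<in>{2..n}. 4 * (1 / sqrt (real m - 1) - 1 / sqrt m))"
    using pos by (intro sum_mono2 mult_nonneg_nonneg) (auto dest: primes_in_ge2 simp: primes_inD)
  also have "\<dots> \<le> 4 * (1 - 1 / sqrt (real (max 1 n)))"
  proof (induction n)
    case (Suc n)
    show ?case
    proof (cases "n = 0")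
      case False
      then have "{2..Suc n} = insert (Suc n) {2..n}" by auto
      with Suc False show ?thesis by (simp add: max_def)
    qed auto
  qed auto
  also have "\<dots> \<le> 4" by simp
  finally show ?thesis .
qed

text \<open>A prime power \<open>p ^ k <= n\<close> has \<open>p <= n\<close> and
  \<open>k <= n\<close>, so the index set may be enlarged to a full rectangle; the sum over
  \<open>k\<close> is then a partial geometric series.\<close>

lemma sum_mangoldt_le:
  "(\<Sum>d=1..n. mangoldt d / real d) \<le> (\<Sum>p\<in>primes_in 0 n. ln p / (real p - 1))"
proof -
  let ?g = "\<lambda>(p,k). p ^ k :: nat" and ?I = "primes_in 0 n \<times> {1..n}"
  have "(\<Sum>d=1..n. mangoldt d / real d) = (\<Sum>d | d \<in> {1..n} \<and> primepow d. mangoldt d / real d)"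
    by (rule sum.mono_neutral_right) (auto simp: mangoldt_def)
  also have "\<dots> \<le> (\<Sum>d\<in>?g ` ?I. mangoldt d / real d)"
  proof (rule sum_mono2)
    show "{d. d \<in> {1..n} \<and> primepow d} \<subseteq> ?g ` ?I"
    proof
      fix d assume d: "d \<in> {d. d \<in> {1..n} \<and> primepow d}"
      then obtain p k where pk: "prime p" "k > 0" "d = p ^ k" by (auto simp: primepow_def)
      have "k < p ^ k" using power_gt_expt[of p k] prime_gt_1_nat[OF pk(1)] by simp
      moreover have "p \<le> p ^ k" using pk by (simp add: prime_gt_0_nat self_le_power Suc_leI)
      ultimately have "(p,k) \<in> ?I" using d pk by (auto simp: primes_in_def prime_gt_0_nat)
      then show "d \<in> ?g ` ?I" using pk by (intro image_eqI[of _ _ "(p,k)"]) auto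
    qed
  qed (auto simp: mangoldt_nonneg)
  also have "\<dots> \<le> (\<Sum>x\<in>?I. mangoldt (?g x) / real (?g x))"
    by (rule sum_image_le[of _ "\<lambda>d. mangoldt d / real d", unfolded o_def]) (auto simp: mangoldt_nonneg)
  also have "\<dots> = (\<Sum>p\<in>primes_in 0 n. \<Sum>k=1..n. ln p / p ^ k)"
    by (subst sum.cartesian_product) (auto intro!: sum.cong simp: primes_in_def)
  also have "\<dots> \<le> (\<Sum>p\<in>primes_in 0 n. ln p / (real p - 1))"
  proof (intro sum_mono)
    fix p assume p: "p \<in> primes_in 0 n"
    then have p2: "p \<ge> 2" by (rule primes_in_ge2)
    have "(\<Sum>k=1..n. 1 / real p ^ k) = (1 - 1 / real p ^ n) / (real p - 1)"
    proof (induction n)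
      case (Suc n)
      have "(\<Sum>k=1..Suc n. 1 / real p ^ k) = (1 - 1 / real p ^ n) / (real p - 1) + 1 / real p ^ Suc n"
        using Suc by simp
      also have "\<dots> = (1 - 1 / real p ^ Suc n) / (real p - 1)"
        using p2 by (simp add: field_simps)
      finally show ?case .
    qed (use p2 in auto)
    also have "\<dots> \<le> 1 / (real p - 1)" using p2 by (intro divide_right_mono) auto
    finally have "ln p * (\<Sum>k=1..n. 1 / real p ^ k) \<le> ln p * (1 / (real p - 1))"
      using p2 by (intro mult_left_mono) auto
    then show "(\<Sum>k=1..n. ln p / p ^ k) \<le> ln p / (real p - 1)"
      by (simp add: sum_distrib_left)
  qed
  finally show ?thesis .
qed

text \<open>All floors in the expansion of \<open>ln (fact n)\<close> are dropped. Of the constant,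
  1 comes from the lower bound for \<open>ln (fact n)\<close> and 4 from the proper prime
  powers.\<close>

lemma prime_log_sum_ge:
  assumes "n > 0"
  shows "ln n - 5 \<le> prime_log_sum n"
proof -
  have "n * ln n - n \<le> (\<Sum>d=1..n. mangoldt d * real (n div d))"
    using ln_fact_ge[of n] by (simp add: ln_fact_mangoldt)
  also have "\<dots> \<le> (\<Sum>d=1..n. mangoldt d * (real n / real d))"
    by (intro sum_mono mult_left_mono of_nat_div_le_of_nat mangoldt_nonneg)
  also have "\<dots> = n * (\<Sum>d=1..n. mangoldt d / real d)"
    by (simp add: sum_distrib_left field_simps)
  also have "\<dots> \<le> n * (\<Sum>p\<in>primes_in 0 n. ln p / (real p - 1))"
    by (intro mult_left_mono sum_mangoldt_le) auto
  finally have "real n * (ln n - 1) \<le> n * (\<Sum>p\<in>primes_in 0 n. ln p / (real p - 1))"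
    by (simp add: algebra_simps)
  then have "ln n - 1 \<le> (\<Sum>p\<in>primes_in 0 n. ln p / (real p - 1))" using assms by simp
  also have "\<dots> = prime_log_sum n + (\<Sum>p\<in>primes_in 0 n. ln p / (p * (real p - 1)))"
    unfolding prime_log_sum_def sum.distrib[symmetric]
  proof (intro sum.cong refl)
    fix p assume "p \<in> primes_in 0 n"
    then have "p \<ge> 2" by (rule primes_in_ge2)
    then show "ln p / (real p - 1) = ln p / p + ln p / (p * (real p - 1))"
      by (simp add: divide_simps) (simp add: algebra_simps)
  qed
  also have "\<dots> \<le> prime_log_sum n + 4" using prime_log_tail_le[of n] by simp
  finally show ?thesis by simp
qed

lemma abs_prime_log_sum_diff_le:
  assumes "n > 0"
  shows "\<bar>prime_log_sum n - ln n\<bar> \<le> 5"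
proof -
  have "ln (4::real) \<le> 5" using ln_le_minus_one[of "4::real"] by simp
  then show ?thesis using prime_log_sum_le[OF assms] prime_log_sum_ge[OF assms] by linarith
qed

section \<open>Mertens' second estimate, by partial summation\<close>

lemma sum_inverse_primes_Suc:
  assumes "2 \<le> u" "u \<le> v"
  shows "(\<Sum>p\<in>primes_in u (Suc v). 1 / p) = (\<Sum>p\<in>primes_in u v. 1 / p)
            + (prime_log_sum (Suc v) - prime_log_sum v) / ln (Suc v)"
proof -
  have "primes_in u (Suc v) = (if prime (Suc v) then insert (Suc v) (primes_in u v) else primes_in u v)"
    using assms by (auto simp: primes_in_def le_Suc_eq)
  moreover have "Suc v \<notin> primes_in a v" for a by (auto simp: primes_in_def)
  ultimately show ?thesis using assms by (simp add: prime_log_sum_def primes_in_0_Suc)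
qed

lemma abs_sum_inverse_primes_diff_le:
  assumes "2 \<le> u" "u \<le> v"
  shows "\<bar>(\<Sum>p\<in>primes_in u v. 1 / p) - (ln (ln v) - ln (ln u))\<bar> \<le> 11 / ln u"
proof -
  define R where "R = (\<lambda>n. prime_log_sum n - ln (real n))"
  have R: "\<bar>R n\<bar> \<le> 5" if "n \<ge> 2" for n
    using abs_prime_log_sum_diff_le[of n] that by (simp add: R_def)
  define E where "E = (\<lambda>v. (\<Sum>p\<in>primes_in u v. 1 / real p) - (ln (ln v) - ln (ln u)))"
  \<comment> \<open>Partial summation in incremental form: the boundary term \<open>R v / ln v\<close> is carried along.\<close>
  have "\<bar>E v - R v / ln v + R u / ln u\<bar> \<le> 6 * (1 / ln u - 1 / ln v)"
    using assms(2)
  proof (induction v rule: dec_induct)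
    case base
    have "primes_in u u = {}" by (auto simp: primes_in_def)
    then show ?case by (simp add: E_def)
  next
    case (step n)
    have n: "n \<ge> 2" using step assms by simp
    define a b where "a = ln (real n)" and "b = ln (real (Suc n))"
    have ab: "0 < a" "a < b" using n by (auto simp: a_def b_def)
    have "ln (real (Suc n) / real n) \<le> real (Suc n) / real n - 1"
      using n by (intro ln_le_minus_one) auto
    also have "\<dots> \<le> 1" using n by (simp add: field_simps)
    finally have ba: "b - a \<le> 1" using n by (simp add: ln_div a_def b_def)
    have "ln (b / a) \<le> b / a - 1" using ab by (intro ln_le_minus_one) auto
    then have u1: "ln b - ln a \<le> (b - a) / a" using ab by (simp add: ln_div field_simps)
    have "ln (a / b) \<le> a / b - 1" using ab by (intro ln_le_minus_one) auto
    then have l1: "(b - a) / b \<le> ln b - ln a" using ab by (simp add: ln_div field_simps)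
    have E': "E (Suc n) - E n = (b + R (Suc n) - a - R n) / b - (ln b - ln a)"
      using sum_inverse_primes_Suc[OF assms(1) step.hyps(1)]
      by (simp add: E_def R_def a_def b_def)
    have d: "1 / a - 1 / b \<ge> 0" using ab by (simp add: frac_le)
    have "(E (Suc n) - R (Suc n) / b) - (E n - R n / a)
        = ((b - a) / b - (ln b - ln a)) + R n * (1 / a - 1 / b)"
      using E' ab by (simp add: diff_divide_distrib add_divide_distrib algebra_simps)
    moreover have "\<bar>(b - a) / b - (ln b - ln a)\<bar> \<le> (b - a) * (1 / a - 1 / b)"
      using u1 l1 by (simp add: algebra_simps)
    moreover have "\<dots> \<le> 1 * (1 / a - 1 / b)" using ba d by (intro mult_right_mono)
    moreover have "\<bar>R n * (1 / a - 1 / b)\<bar> \<le> 5 * (1 / a - 1 / b)"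
      unfolding abs_mult using R[OF n] d by (intro mult_mono) auto
    ultimately have "\<bar>(E (Suc n) - R (Suc n) / b) - (E n - R n / a)\<bar> \<le> 6 * (1 / a - 1 / b)"
      by linarith
    then show ?case using step.IH unfolding a_def[symmetric] b_def[symmetric] by argo
  qed
  moreover have "\<bar>R v / ln v\<bar> \<le> 5 * (1 / ln v)"
    using R[of v] assms by (simp add: abs_divide divide_right_mono)
  moreover have "\<bar>R u / ln u\<bar> \<le> 5 * (1 / ln u)"
    using R[of u] assms by (simp add: abs_divide divide_right_mono)
  moreover have "1 / ln v \<ge> 0" using assms by simp
  \<comment> \<open>The boundary term at \<open>u\<close> contributes 5 and the increments 6; the
    boundary term at \<open>v\<close> is absorbed by the \<open>- 6 / ln v\<close> left over from
    the telescoped increments.\<close>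
  ultimately have "\<bar>E v\<bar> \<le> 11 * (1 / ln u)"  by argo
  then show ?thesis by (simp add: E_def)
qed

section \<open>The independent model\<close>

text \<open>Point mass of the product Bernoulli measure on the subsets of \<open>P\<close>.
  Probabilities of events are finite sums of point masses, so no measure theory enters.\<close>

definition bern_weight :: "('a \<Rightarrow> real) \<Rightarrow> 'a set \<Rightarrow> 'a set \<Rightarrow> real" where
  "bern_weight w P S = (\<Prod>p\<in>S. w p) * (\<Prod>p\<in>P - S. 1 - w p)"

definition bern_prob :: "('a \<Rightarrow> real) \<Rightarrow> 'a set \<Rightarrow> ('a set \<Rightarrow> bool) \<Rightarrow> real" where
  "bern_prob w P E = (\<Sum>S | S \<subseteq> P \<and> E S. bern_weight w P S)"

lemma bern_weight_nonneg:
  assumes "\<And>p. p \<in> P \<Longrightarrow> 0 \<le> w p \<and> w p \<le> 1" "S \<subseteq> P"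
  shows "0 \<le> bern_weight w P S"
  unfolding bern_weight_def using assms by (intro mult_nonneg_nonneg prod_nonneg) auto

lemma bern_prob_True:
  assumes "finite P"
  shows "bern_prob w P (\<lambda>_. True) = 1"
  using prod_add[OF assms, of w "\<lambda>p. 1 - w p"]
  by (simp add: bern_prob_def bern_weight_def Pow_def)

lemma bern_prob_mono:
  assumes "finite P" "\<And>p. p \<in> P \<Longrightarrow> 0 \<le> w p \<and> w p \<le> 1" "\<And>S. S \<subseteq> P \<Longrightarrow> E S \<Longrightarrow> G S"
  shows "bern_prob w P E \<le> bern_prob w P G"
  unfolding bern_prob_def using assms
  by (intro sum_mono2) (auto intro: bern_weight_nonneg)

lemma bern_prob_cong:
  assumes "\<And>S. S \<subseteq> P \<Longrightarrow> E S \<longleftrightarrow> G S"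
  shows "bern_prob w P E = bern_prob w P G"
  unfolding bern_prob_def using assms by (intro sum.cong) auto

lemma bern_prob_disj_eq:
  assumes "finite P" "\<And>S. S \<subseteq> P \<Longrightarrow> \<not> (E S \<and> G S)"
  shows "bern_prob w P (\<lambda>S. E S \<or> G S) = bern_prob w P E + bern_prob w P G"
proof -
  have "{S. S \<subseteq> P \<and> (E S \<or> G S)} = {S. S \<subseteq> P \<and> E S} \<union> {S. S \<subseteq> P \<and> G S}" by auto
  then show ?thesis unfolding bern_prob_def using assms
    by (simp add: sum.union_disjoint disjoint_iff)
qed

lemma bern_prob_disj_le:
  assumes "finite P" "\<And>p. p \<in> P \<Longrightarrow> 0 \<le> w p \<and> w p \<le> 1"
  shows "bern_prob w P (\<lambda>S. E S \<or> G S) \<le> bern_prob w P E + bern_prob w P G"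
proof -
  have "bern_prob w P (\<lambda>S. E S \<or> G S) = bern_prob w P (\<lambda>S. E S \<or> (G S \<and> \<not> E S))"
    by (rule bern_prob_cong) auto
  also have "\<dots> = bern_prob w P E + bern_prob w P (\<lambda>S. G S \<and> \<not> E S)"
    by (rule bern_prob_disj_eq) (use assms in auto)
  also have "bern_prob w P (\<lambda>S. G S \<and> \<not> E S) \<le> bern_prob w P G"
    by (rule bern_prob_mono) (use assms in auto)
  finally show ?thesis by simp
qed

lemma bern_prob_Bex_le:
  assumes "finite P" "\<And>p. p \<in> P \<Longrightarrow> 0 \<le> w p \<and> w p \<le> 1" "finite I"
  shows "bern_prob w P (\<lambda>S. \<exists>i\<in>I. E i S) \<le> (\<Sum>i\<in>I. bern_prob w P (E i))"
  using assms(3)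
proof (induction I rule: finite_induct)
  case empty
  then show ?case by (simp add: bern_prob_def)
next
  case (insert i I)
  have "bern_prob w P (\<lambda>S. \<exists>i\<in>insert i I. E i S) = bern_prob w P (\<lambda>S. E i S \<or> (\<exists>i\<in>I. E i S))"
    by simp
  also have "\<dots> \<le> bern_prob w P (E i) + bern_prob w P (\<lambda>S. \<exists>i\<in>I. E i S)"
    by (rule bern_prob_disj_le) (use assms in auto)
  finally show ?case using insert by simp
qed

text \<open>Subsets of a disjoint union correspond to pairs of subsets, and the point mass factors
  along this correspondence.\<close>

lemma bern_prob_indep:
  assumes "finite A" "finite B" "A \<inter> B = {}"
  shows "bern_prob w (A \<union> B) (\<lambda>S. E (S \<inter> A) \<and> G (S \<inter> B)) = bern_prob w A E * bern_prob w B G"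
proof -
  have "bern_prob w A E * bern_prob w B G
      = (\<Sum>X\<in>{S. S \<subseteq> A \<and> E S} \<times> {S. S \<subseteq> B \<and> G S}. bern_weight w A (fst X) * bern_weight w B (snd X))"
    by (simp add: bern_prob_def sum_product sum.cartesian_product case_prod_unfold)
  also have "\<dots> = bern_prob w (A \<union> B) (\<lambda>S. E (S \<inter> A) \<and> G (S \<inter> B))"
    unfolding bern_prob_def
  proof (rule sum.reindex_bij_witness[of _ "\<lambda>S. (S \<inter> A, S \<inter> B)" "\<lambda>X. fst X \<union> snd X"])
    fix X assume X: "X \<in> {S. S \<subseteq> A \<and> E S} \<times> {S. S \<subseteq> B \<and> G S}"
    then obtain S T where ST: "X = (S, T)" "S \<subseteq> A" "T \<subseteq> B" "E S" "G T" by auto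
    have e: "(S \<union> T) \<inter> A = S" "(S \<union> T) \<inter> B = T" using ST assms(3) by auto
    show "((fst X \<union> snd X) \<inter> A, (fst X \<union> snd X) \<inter> B) = X" using ST e by simp
    show "fst X \<union> snd X \<in> {S. S \<subseteq> A \<union> B \<and> E (S \<inter> A) \<and> G (S \<inter> B)}"
      using ST e by auto
    have fin: "finite S" "finite T" using ST(2,3) assms(1,2) by (simp_all add: finite_subset)
    have "A \<union> B - (S \<union> T) = (A - S) \<union> (B - T)" using ST assms by auto
    then have "(\<Prod>p\<in>A \<union> B - (S \<union> T). 1 - w p) = (\<Prod>p\<in>A - S. 1 - w p) * (\<Prod>p\<in>B - T. 1 - w p)"
      using assms ST by (simp add: prod.union_disjoint disjoint_iff)
    moreover have "prod w (S \<union> T) = prod w S * prod w T"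
      using fin ST assms by (intro prod.union_disjoint) auto
    ultimately show "bern_weight w (A \<union> B) (fst X \<union> snd X)
        = bern_weight w A (fst X) * bern_weight w B (snd X)"
      by (simp add: ST bern_weight_def)
  qed (use assms in auto)
  finally show ?thesis by simp
qed

lemma bern_prob_restrict:
  assumes "finite P" "A \<subseteq> P"
  shows "bern_prob w P (\<lambda>S. E (S \<inter> A)) = bern_prob w A E"
  using bern_prob_indep[of A "P - A" w E "\<lambda>_. True"] assms bern_prob_True[of "P - A" w]
  by (simp add: finite_subset Un_absorb1)

text \<open>That an event depends only on the coordinates in \<open>A\<close> is expressed by its
  invariance under intersecting the sample with \<open>A\<close>.\<close>

lemma bern_prob_indep_events:
  assumes "finite P" "A \<subseteq> P" "B \<subseteq> P" "A \<inter> B = {}"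
    "\<And>S. S \<subseteq> P \<Longrightarrow> E S \<longleftrightarrow> E (S \<inter> A)" "\<And>S. S \<subseteq> P \<Longrightarrow> G S \<longleftrightarrow> G (S \<inter> B)"
  shows "bern_prob w P (\<lambda>S. E S \<and> G S) = bern_prob w P E * bern_prob w P G"
proof -
  have fin: "finite A" "finite B" by (rule finite_subset[OF _ assms(1)], fact)+
  have "bern_prob w P (\<lambda>S. E S \<and> G S)
      = bern_prob w P (\<lambda>S. (\<lambda>U. E (U \<inter> A) \<and> G (U \<inter> B)) (S \<inter> (A \<union> B)))"
    using assms(5,6) by (intro bern_prob_cong) (simp add: Int_assoc Int_absorb1)
  also have "\<dots> = bern_prob w A E * bern_prob w B G"
    using assms fin by (subst bern_prob_restrict) (auto simp: bern_prob_indep)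
  also have "bern_prob w A E = bern_prob w P E"
    using bern_prob_restrict[OF assms(1,2), of w E] bern_prob_cong[of P E "\<lambda>S. E (S \<inter> A)" w] assms(5)
    by simp
  also have "bern_prob w B G = bern_prob w P G"
    using bern_prob_restrict[OF assms(1,3), of w G] bern_prob_cong[of P G "\<lambda>S. G (S \<inter> B)" w] assms(6)
    by simp
  finally show ?thesis .
qed

lemma bern_prob_isolated:
  assumes "finite P" "p \<in> P" "Q \<subseteq> P" "p \<notin> Q"
  shows "bern_prob w P (\<lambda>S. p \<in> S \<and> S \<inter> Q = {}) = w p * (\<Prod>q\<in>Q. 1 - w q)"
proof -
  have "finite Q" using assms finite_subset by auto
  have "bern_prob w P (\<lambda>S. p \<in> S \<and> S \<inter> Q = {})
      = bern_prob w P (\<lambda>S. (\<lambda>U. p \<in> U \<and> U \<inter> Q = {}) (S \<inter> insert p Q))"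
    by (rule bern_prob_cong) auto
  also have "\<dots> = bern_prob w (insert p Q) (\<lambda>S. p \<in> S \<and> S \<inter> Q = {})"
    using assms by (intro bern_prob_restrict) auto
  also have "\<dots> = bern_weight w (insert p Q) {p}"
  proof -
    have "{S. S \<subseteq> insert p Q \<and> p \<in> S \<and> S \<inter> Q = {}} = {{p}}" using assms by auto
    then show ?thesis by (simp add: bern_prob_def)
  qed
  also have "\<dots> = w p * (\<Prod>q\<in>Q. 1 - w q)"
    using assms by (simp add: bern_weight_def insert_Diff_if)
  finally show ?thesis .
qed

section \<open>Gaps in the model\<close>

text \<open>No prime beyond \<open>p ^ K\<close> is demanded, in contrast to \<open>long_gap\<close>
  below, so that the event is local to the primes from \<open>p\<close> to
  \<open>p ^ K\<close>.\<close>

definition gap_from :: "nat \<Rightarrow> nat \<Rightarrow> nat set \<Rightarrow> bool" where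
  "gap_from K p S \<longleftrightarrow> p \<in> S \<and> S \<inter> {p<..p ^ K} = {}"

definition gap_prob :: "nat \<Rightarrow> nat \<Rightarrow> real" where
  "gap_prob K p = 1 / real p * (\<Prod>q\<in>primes_in p (p ^ K). 1 - 1 / real q)"

abbreviation prime_model :: "nat \<Rightarrow> (nat set \<Rightarrow> bool) \<Rightarrow> real" where
  "prime_model y E \<equiv> bern_prob (\<lambda>p. 1 / real p) (primes_in 0 y) E"

lemma prime_weights: "p \<in> primes_in u v \<Longrightarrow> 0 \<le> 1 / real p \<and> 1 / real p \<le> 1"
  using primes_in_ge2[of p u v] by auto

lemma prime_model_gap_from:
  assumes "prime p" "p ^ K \<le> y" "K > 0"
  shows "prime_model y (gap_from K p) = gap_prob K p"
proof -
  have "p \<le> p ^ K" using assms by (simp add: prime_gt_0_nat self_le_power Suc_leI)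
  then have p: "p \<in> primes_in 0 y" using assms by (auto simp: primes_in_def prime_gt_0_nat)
  have "prime_model y (gap_from K p) = prime_model y (\<lambda>S. p \<in> S \<and> S \<inter> primes_in p (p ^ K) = {})"
    by (rule bern_prob_cong) (auto simp: gap_from_def primes_in_def)
  also have "\<dots> = gap_prob K p"
    unfolding gap_prob_def using assms p by (intro bern_prob_isolated) (auto simp: primes_in_def)
  finally show ?thesis .
qed

text \<open>Gaps opened up to \<open>m\<close> extend as far as \<open>m ^ K\<close>; the estimates
  below therefore take \<open>m ^ K <= y\<close>, and keep \<open>y\<close> fixed while
  \<open>m\<close> grows.\<close>

definition no_gap_prob :: "nat \<Rightarrow> nat \<Rightarrow> nat \<Rightarrow> real" where
  "no_gap_prob y K m = prime_model y (\<lambda>S. \<forall>p\<le>m. \<not> gap_from K p S)"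

lemma gap_prob_nonneg: "0 \<le> gap_prob K p"
  unfolding gap_prob_def
  by (intro mult_nonneg_nonneg prod_nonneg) (auto dest: prime_weights)

lemma gap_prob_le_inverse: "gap_prob K p \<le> 1 / real p"
proof -
  have "(\<Prod>q\<in>primes_in p (p ^ K). 1 - 1 / real q) \<le> 1"
    by (intro prod_le_1) (auto dest: prime_weights)
  then show ?thesis unfolding gap_prob_def by (simp add: mult_left_le divide_right_mono)
qed

lemma gap_prob_le_1: "gap_prob K p \<le> 1"
proof (cases "p = 0")
  case False
  then show ?thesis using gap_prob_le_inverse[of K p] by (simp add: order_trans[of _ "1 / real p"])
qed (simp add: gap_prob_def)

lemma le_of_power_le:
  fixes q m K :: nat
  assumes "q ^ K \<le> m" "K > 0"
  shows "q \<le> m"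
proof (cases "q = 0")
  case False
  then have "q \<le> q ^ K" using assms(2) by (simp add: self_le_power)
  with assms(1) show ?thesis by simp
qed simp

text \<open>If \<open>p\<close> is the least prime that opens a gap, then the gaps opened by the primes \<open>q < p\<close> with
  \<open>p \<le> q ^ K\<close> are excluded by the presence of \<open>p\<close> alone, and the remaining conditions
  are independent of the gap at \<open>p\<close>.\<close>

lemma no_gap_prob_step:
  assumes p: "prime (Suc m)" and y: "Suc m ^ K \<le> y" and K: "K > 0"
  shows "no_gap_prob y K (Suc m) = no_gap_prob y K m
           - gap_prob K (Suc m) * prime_model y (\<lambda>S. \<forall>q. q ^ K \<le> m \<longrightarrow> \<not> gap_from K q S)"
proof -
  let ?p = "Suc m" and ?P = "primes_in 0 y"
  let ?H = "\<lambda>S. \<forall>q. q ^ K \<le> m \<longrightarrow> \<not> gap_from K q S"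
  have "?p \<le> ?p ^ K" using K by (simp add: self_le_power)
  have low: "q \<le> m" if "q ^ K \<le> m" for q using that K by (rule le_of_power_le)
  have "no_gap_prob y K m = prime_model y (\<lambda>S. (\<forall>q\<le>?p. \<not> gap_from K q S) \<or> (gap_from K ?p S \<and> (\<forall>q\<le>m. \<not> gap_from K q S)))"
    unfolding no_gap_prob_def by (rule bern_prob_cong) (auto simp: le_Suc_eq)
  also have "\<dots> = no_gap_prob y K ?p + prime_model y (\<lambda>S. gap_from K ?p S \<and> (\<forall>q\<le>m. \<not> gap_from K q S))"
    unfolding no_gap_prob_def by (rule bern_prob_disj_eq) auto
  also have "prime_model y (\<lambda>S. gap_from K ?p S \<and> (\<forall>q\<le>m. \<not> gap_from K q S))
      = prime_model y (\<lambda>S. gap_from K ?p S \<and> ?H S)"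
  proof (rule bern_prob_cong, safe)
    fix S q assume "gap_from K ?p S" "?H S" "q \<le> m" "gap_from K q S"
    then show False by (cases "q ^ K \<le> m") (auto simp: gap_from_def disjoint_iff)
  qed (use low in auto)
  also have "\<dots> = prime_model y (gap_from K ?p) * prime_model y ?H"
  proof (rule bern_prob_indep_events[where A = "{p\<in>?P. ?p \<le> p}" and B = "{p\<in>?P. p < ?p}"])
    fix S assume S: "S \<subseteq> ?P"
    have "p \<in> ?P" if "p \<in> S" for p using that S by blast
    then show "gap_from K ?p S = gap_from K ?p (S \<inter> {p\<in>?P. ?p \<le> p})"
      by (auto simp: gap_from_def disjoint_iff Suc_le_eq)
    have "gap_from K q S = gap_from K q (S \<inter> {p\<in>?P. p < ?p})" if "q ^ K \<le> m" for q
      using S low[OF that] that by (auto simp: gap_from_def disjoint_iff) 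
    then show "?H S = ?H (S \<inter> {p\<in>?P. p < ?p})" by blast
  qed auto
  also have "prime_model y (gap_from K ?p) = gap_prob K ?p"
    using assms by (intro prime_model_gap_from)
  finally show ?thesis by simp
qed

lemma no_gap_prob_Suc_not_prime:
  assumes "\<not> prime (Suc m)"
  shows "no_gap_prob y K (Suc m) = no_gap_prob y K m"
  unfolding no_gap_prob_def using assms
  by (intro bern_prob_cong) (auto simp: le_Suc_eq gap_from_def primes_in_def)

lemma no_gap_prob_0: "no_gap_prob y K 0 = 1"
proof -
  have "no_gap_prob y K 0 = prime_model y (\<lambda>_. True)"
    unfolding no_gap_prob_def by (rule bern_prob_cong) (auto simp: gap_from_def primes_in_def)
  then show ?thesis by (simp add: bern_prob_True)
qed

section \<open>Size of a single gap probability\<close>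

lemma ln_ln_power:
  assumes "p \<ge> 2" "K > 0"
  shows "ln (ln (real (p ^ K))) = ln K + ln (ln (real p))"
  using assms by (simp add: ln_realpow ln_mult)

lemma prod_one_minus_le_exp:
  "(\<Prod>q\<in>primes_in u v. 1 - 1 / real q) \<le> exp (- (\<Sum>q\<in>primes_in u v. 1 / real q))"
proof -
  have "(\<Prod>q\<in>primes_in u v. 1 - 1 / real q) \<le> (\<Prod>q\<in>primes_in u v. exp (- (1 / real q)))"
    using exp_ge_add_one_self[of "- (1 / real q)" for q] 
    by (intro prod_mono) (auto dest: prime_weights)
  also have "\<dots> = exp (- (\<Sum>q\<in>primes_in u v. 1 / real q))"
    by (simp add: exp_sum sum_negf[symmetric])
  finally show ?thesis .
qed

lemma sum_inverse_mult_pred_le: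
  assumes "u > 0"
  shows "(\<Sum>q\<in>primes_in u v. 1 / (real q * (real q - 1))) \<le> 1 / real u"
proof -
  have tel: "(\<Sum>q\<in>{u<..n}. 1 / (real q * (real q - 1))) \<le> 1 / real u - 1 / real n" if "u \<le> n" for n
    using that
  proof (induction n rule: dec_induct)
    case (step n)
    have "{u<..Suc n} = insert (Suc n) {u<..n}" using step by auto
    moreover have "1 / (real (Suc n) * (real (Suc n) - 1)) = 1 / real n - 1 / real (Suc n)"
      using assms step.hyps by (simp add: field_simps)
    ultimately show ?case using step.IH by simp
  qed simp
  have "(\<Sum>q\<in>primes_in u v. 1 / (real q * (real q - 1))) \<le> (\<Sum>q\<in>{u<..max u v}. 1 / (real q * (real q - 1)))"
    using assms by (intro sum_mono2) (auto simp: primes_in_def)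
  also have "\<dots> \<le> 1 / real u - 1 / real (max u v)" by (rule tel) simp
  also have "\<dots> \<le> 1 / real u" by simp
  finally show ?thesis .
qed

text \<open>\<open>1 - 1 / q\<close> is the inverse of \<open>1 + 1 / (q - 1)\<close> and hence at
  least \<open>exp (- 1 / (q - 1))\<close>. The excess of \<open>1 / (q - 1)\<close> over
  \<open>1 / q\<close> telescopes to at most \<open>1 / u\<close>.\<close>

lemma prod_one_minus_ge_exp:
  assumes "u > 0"
  shows "exp (- (\<Sum>q\<in>primes_in u v. 1 / real q) - 1 / real u) \<le> (\<Prod>q\<in>primes_in u v. 1 - 1 / real q)"
proof -
  have "(\<Sum>q\<in>primes_in u v. 1 / (real q - 1))
      = (\<Sum>q\<in>primes_in u v. 1 / real q) + (\<Sum>q\<in>primes_in u v. 1 / (real q * (real q - 1)))"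
    unfolding sum.distrib[symmetric]
  proof (intro sum.cong refl)
    fix q assume "q \<in> primes_in u v"
    then have "q \<ge> 2" by (rule primes_in_ge2)
    then show "1 / (real q - 1) = 1 / real q + 1 / (real q * (real q - 1))"
      by (simp add: divide_simps)
  qed
  then have "exp (- (\<Sum>q\<in>primes_in u v. 1 / real q) - 1 / real u) \<le> exp (- (\<Sum>q\<in>primes_in u v. 1 / (real q - 1)))"
    using sum_inverse_mult_pred_le[OF assms, of v] by simp
  also have "\<dots> = (\<Prod>q\<in>primes_in u v. exp (- (1 / (real q - 1))))"
    by (simp add: exp_sum sum_negf[symmetric])
  also have "\<dots> \<le> (\<Prod>q\<in>primes_in u v. 1 - 1 / real q)"
  proof (intro prod_mono conjI)
    fix q assume "q \<in> primes_in u v"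
    then have q: "q \<ge> 2" by (rule primes_in_ge2)
    have "1 + 1 / (real q - 1) \<le> exp (1 / (real q - 1))" by (rule exp_ge_add_one_self)
    then have "exp (- (1 / (real q - 1))) \<le> inverse (1 + 1 / (real q - 1))"
      using q by (simp only: exp_minus) (intro le_imp_inverse_le add_pos_pos, auto)
    also have "\<dots> = 1 - 1 / real q" using q by (simp add: field_simps)
    finally show "exp (- (1 / (real q - 1))) \<le> 1 - 1 / real q" .
  qed auto
  finally show ?thesis .
qed

text \<open>Raising \<open>p\<close> to the power \<open>K\<close> shifts \<open>ln (ln p)\<close>
  by exactly \<open>ln K\<close>, whatever \<open>p\<close> is. By Mertens the reciprocals of the
  primes in the gap sum to about \<open>ln K\<close>, so the product over the gap is about
  \<open>1 / K\<close>.\<close>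

lemma gap_prob_upper:
  assumes "p \<ge> 2" "K > 0"
  shows "gap_prob K p \<le> exp (11 / ln p) / (p * K)"
proof -
  have "p \<le> p ^ K" using assms by (simp add: self_le_power)
  then have "\<bar>(\<Sum>q\<in>primes_in p (p ^ K). 1 / q) - ln K\<bar> \<le> 11 / ln p"
    using abs_sum_inverse_primes_diff_le[of p "p ^ K"] assms ln_ln_power[of p K] by simp
  then have "exp (- (\<Sum>q\<in>primes_in p (p ^ K). 1 / real q)) \<le> exp (11 / ln p - ln K)"
    by simp
  also have "\<dots> = exp (11 / ln p) / K" using assms by (simp add: exp_diff)
  finally have "(\<Prod>q\<in>primes_in p (p ^ K). 1 - 1 / real q) \<le> exp (11 / ln p) / K"
    using prod_one_minus_le_exp[of p "p ^ K"] by linarith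
  then have "1 / real p * (\<Prod>q\<in>primes_in p (p ^ K). 1 - 1 / real q) \<le> 1 / real p * (exp (11 / ln p) / K)"
    by (intro mult_left_mono) auto
  then show ?thesis by (simp add: gap_prob_def)
qed

lemma gap_prob_lower:
  assumes "p \<ge> 2" "K > 0"
  shows "exp (- 12 / ln p) / (p * K) \<le> gap_prob K p"
proof -
  have "p \<le> p ^ K" using assms by (simp add: self_le_power)
  then have 1: "\<bar>(\<Sum>q\<in>primes_in p (p ^ K). 1 / q) - ln K\<bar> \<le> 11 / ln p"
    using abs_sum_inverse_primes_diff_le[of p "p ^ K"] assms ln_ln_power[of p K] by simp
  have "ln p \<le> real p" using ln_le_minus_one[of "real p"] assms by simp
  \<comment> \<open>The loss \<open>1 / p\<close> from the product estimate is absorbed by raising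
    Mertens' constant from 11 to 12.\<close>
  then have "1 / real p \<le> 1 / ln p" using assms by (intro divide_left_mono) auto
  then have "- 12 / ln p - ln K \<le> - (\<Sum>q\<in>primes_in p (p ^ K). 1 / real q) - 1 / real p"
    using 1 by (auto simp: abs_le_iff)
  then have "exp (- 12 / ln p - ln K) \<le> exp (- (\<Sum>q\<in>primes_in p (p ^ K). 1 / real q) - 1 / real p)"
    by simp
  moreover have "exp (- 12 / ln p - ln K) = exp (- 12 / ln p) / K" using assms by (simp add: exp_diff)
  ultimately have "exp (- 12 / ln p) / K \<le> (\<Prod>q\<in>primes_in p (p ^ K). 1 - 1 / real q)"
    using prod_one_minus_ge_exp[of p "p ^ K"] assms by linarith
  then have "1 / real p * (exp (- 12 / ln p) / K) \<le> 1 / real p * (\<Prod>q\<in>primes_in p (p ^ K). 1 - 1 / real q)"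
    by (intro mult_left_mono) auto
  then show ?thesis by (simp add: gap_prob_def)
qed

lemma gap_prob_uniform:
  assumes "p \<ge> 2" "K > 0"
  shows "gap_prob K p \<le> exp (11 / ln 2) / (p * K)"
proof -
  have "exp (11 / ln p) \<le> exp (11 / ln (2::real))" using assms by (auto intro!: divide_left_mono)
  then have "exp (11 / ln p) / (p * K) \<le> exp (11 / ln 2) / (p * K)" by (intro divide_right_mono) auto
  with gap_prob_upper[OF assms] show ?thesis by simp
qed

text \<open>This bounds the defect of independence in the recursion at \<open>p\<close>. The window
  of admissible \<open>q\<close> has \<open>ln ln\<close>-length at most \<open>ln K\<close>, so the
  reciprocals sum to \<open>ln K + O(1)\<close>, and each gap probability carries a further
  \<open>1 / K\<close>.\<close>

lemma sum_gap_prob_window_le: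
  assumes "p \<ge> 2" "K > 0"
  shows "(\<Sum>q | prime q \<and> q < p \<and> p \<le> q ^ K. gap_prob K q)
          \<le> exp (11 / ln 2) * (ln K + 1 + 11 / ln 2) / K"
proof -
  \<comment> \<open>The left end of the window; \<open>z\<close> itself is split off because
    \<open>primes_in\<close> excludes its lower end.\<close>
  define z where "z = (LEAST q. q \<ge> 2 \<and> p \<le> q ^ K)"
  have ex: "p \<ge> 2 \<and> p \<le> p ^ K" using assms by (simp add: self_le_power)
  have z: "z \<ge> 2 \<and> p \<le> z ^ K" unfolding z_def by (rule LeastI[of _ p]) (rule ex)
  have zp: "z \<le> p" unfolding z_def by (rule Least_le) (rule ex)
  let ?Q = "{q. prime q \<and> q < p \<and> p \<le> q ^ K}"
  have sub: "?Q \<subseteq> insert z (primes_in z p)"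
  proof
    fix q assume q: "q \<in> ?Q"
    then have "z \<le> q" unfolding z_def by (intro Least_le) (auto dest: prime_ge_2_nat)
    with q show "q \<in> insert z (primes_in z p)" by (auto simp: primes_in_def)
  qed
  have fin: "finite ?Q" by (rule finite_subset[of _ "{..p}"]) auto
  have "ln p \<le> ln (real (z ^ K))" using z assms by (intro ln_mono) (simp_all del: of_nat_power)
  then have "ln (ln p) \<le> ln (ln (real (z ^ K)))" using ln_mono[of "ln p"] assms by simp
  then have l: "ln (ln p) - ln (ln z) \<le> ln K" using ln_ln_power[of z K] z assms by linarith
  have "(\<Sum>q\<in>?Q. 1 / real q) \<le> (\<Sum>q\<in>insert z (primes_in z p). 1 / real q)"
    by (rule sum_mono2) (use sub in auto)
  also have "\<dots> = 1 / real z + (\<Sum>q\<in>primes_in z p. 1 / real q)"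
    by (subst sum.insert) (auto simp: primes_in_def)
  also have "\<dots> \<le> 1 + (ln K + 11 / ln 2)"
  proof (rule add_mono)
    have "(\<Sum>q\<in>primes_in z p. 1 / real q) \<le> ln (ln p) - ln (ln z) + 11 / ln z"
      using abs_sum_inverse_primes_diff_le[of z p] z zp by auto
    moreover have "11 / ln z \<le> 11 / ln (2::real)" using z by (auto intro!: divide_left_mono)
    ultimately show "(\<Sum>q\<in>primes_in z p. 1 / real q) \<le> ln K + 11 / ln 2" using l by linarith
  qed (use z in auto)
  finally have S: "(\<Sum>q\<in>?Q. 1 / real q) \<le> ln K + 1 + 11 / ln 2" by simp
  have "(\<Sum>q\<in>?Q. gap_prob K q) \<le> (\<Sum>q\<in>?Q. exp (11 / ln 2) / K * (1 / real q))"
    using gap_prob_uniform[of _ K] assms prime_ge_2_nat by (intro sum_mono) (auto simp: mult.commute)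
  also have "\<dots> = exp (11 / ln 2) / K * (\<Sum>q\<in>?Q. 1 / real q)" by (simp add: sum_distrib_left)
  also have "\<dots> \<le> exp (11 / ln 2) / K * (ln K + 1 + 11 / ln 2)"
    using S by (intro mult_left_mono) auto
  finally show ?thesis by simp
qed

text \<open>With \<open>F\<close> and \<open>G\<close> the two quantities at \<open>m\<close> and
  \<open>a\<close> the gap probability at the next prime, the recursion reads
  \<open>F - a * H\<close>, where \<open>H\<close> ignores the gaps opened in the window and so
  satisfies \<open>F <= H <= F + \<delta>\<close>. The new difference is
  \<open>(1 - a) * (F - G) - a * (H - F)\<close>: old errors are not amplified, and each prime adds
  at most \<open>a * \<delta>\<close>.\<close>

lemma abs_no_gap_prob_diff_le:
  assumes "m ^ K \<le> y" "K > 0"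
  defines "\<delta> \<equiv> exp (11 / ln 2) * (ln K + 1 + 11 / ln 2) / K"
  shows "\<bar>no_gap_prob y K m - (\<Prod>p\<in>primes_in 0 m. 1 - gap_prob K p)\<bar>
          \<le> \<delta> * (\<Sum>p\<in>primes_in 0 m. gap_prob K p)"
  using assms(1)
proof (induction m)
  case 0
  have "primes_in 0 0 = {}" by (auto simp: primes_in_def)
  then show ?case by (simp add: no_gap_prob_0)
next
  case (Suc m)
  have "m ^ K \<le> Suc m ^ K" by (intro power_mono) auto
  with Suc have IH: "\<bar>no_gap_prob y K m - (\<Prod>p\<in>primes_in 0 m. 1 - gap_prob K p)\<bar>
          \<le> \<delta> * (\<Sum>p\<in>primes_in 0 m. gap_prob K p)" by simp
  show ?case
  proof (cases "prime (Suc m)")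
    case False
    then show ?thesis using IH by (simp add: no_gap_prob_Suc_not_prime primes_in_0_Suc)
  next
    case True
    let ?a = "gap_prob K (Suc m)"
    define H where "H = prime_model y (\<lambda>S. \<forall>q. q ^ K \<le> m \<longrightarrow> \<not> gap_from K q S)"
    define G where "G = (\<Prod>p\<in>primes_in 0 m. 1 - gap_prob K p)"
    define F where "F = no_gap_prob y K m"
    have low: "q \<le> m" if "q ^ K \<le> m" for q using that assms(2) by (rule le_of_power_le)
    have "F \<le> H"
      unfolding F_def H_def no_gap_prob_def using low by (intro bern_prob_mono prime_weights) auto
    moreover have "H \<le> F + \<delta>"
    proof -
      let ?Q = "{q. prime q \<and> q < Suc m \<and> Suc m \<le> q ^ K}"
      have fin: "finite ?Q" by (rule finite_subset[of _ "{..m}"]) auto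
      have "H \<le> prime_model y (\<lambda>S. (\<forall>q\<le>m. \<not> gap_from K q S) \<or> (\<exists>q\<in>?Q. gap_from K q S))"
        unfolding H_def
      proof (rule bern_prob_mono)
        fix S assume "S \<subseteq> primes_in 0 y" "\<forall>q. q ^ K \<le> m \<longrightarrow> \<not> gap_from K q S"
        then have "q \<in> ?Q" if "q \<le> m" "gap_from K q S" for q
          using that not_less_eq_eq[of "q ^ K" m] by (auto simp: gap_from_def primes_in_def subset_iff)
        then show "(\<forall>q\<le>m. \<not> gap_from K q S) \<or> (\<exists>q\<in>?Q. gap_from K q S)" by blast
      qed (auto dest: prime_weights)
      also have "\<dots> \<le> F + prime_model y (\<lambda>S. \<exists>q\<in>?Q. gap_from K q S)"
        unfolding F_def no_gap_prob_def by (rule bern_prob_disj_le) (auto dest: prime_weights)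
      also have "prime_model y (\<lambda>S. \<exists>q\<in>?Q. gap_from K q S) \<le> (\<Sum>q\<in>?Q. prime_model y (gap_from K q))"
        using fin by (intro bern_prob_Bex_le) (auto dest: prime_weights)
      also have "\<dots> = (\<Sum>q\<in>?Q. gap_prob K q)"
      proof (intro sum.cong refl prime_model_gap_from)
        fix q assume q: "q \<in> ?Q"
        have "q ^ K \<le> Suc m ^ K" using q by (intro power_mono) auto
        then show "q ^ K \<le> y" using Suc.prems by simp
      qed (use assms in auto)
      also have "\<dots> \<le> \<delta>"
        unfolding \<delta>_def using True assms(2) prime_ge_2_nat[OF True]
        by (intro sum_gap_prob_window_le) auto
      finally show ?thesis by simp
    qed
    ultimately have HF: "\<bar>H - F\<bar> \<le> \<delta>" by linarith
    have a: "0 \<le> ?a" "?a \<le> 1" by (rule gap_prob_nonneg, rule gap_prob_le_1)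
    have step: "no_gap_prob y K (Suc m) = F - ?a * H"
      unfolding F_def H_def using no_gap_prob_step[OF True Suc.prems assms(2)] .
    have prim: "primes_in 0 (Suc m) = insert (Suc m) (primes_in 0 m)" "Suc m \<notin> primes_in 0 m"
      using True by (auto simp: primes_in_def le_Suc_eq)
    have "no_gap_prob y K (Suc m) - (1 - ?a) * G = (1 - ?a) * (F - G) - ?a * (H - F)"
      unfolding step by (simp add: algebra_simps)
    also have "\<bar>\<dots>\<bar> \<le> \<bar>(1 - ?a) * (F - G)\<bar> + \<bar>?a * (H - F)\<bar>" by (rule abs_triangle_ineq4)
    also have "\<dots> \<le> 1 * \<bar>F - G\<bar> + ?a * \<delta>"
      unfolding abs_mult using a HF by (intro add_mono mult_mono) auto
    finally show ?thesis
      using IH prim by (simp add: F_def G_def algebra_simps)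
  qed
qed

text \<open>Products of factors of modulus at most 1 differ by no more than the sum of the
  differences of their factors, here \<open>1 - a i\<close> against
  \<open>exp (- a i)\<close>.\<close>

lemma abs_prod_one_minus_diff_exp_le:
  fixes a :: "'a \<Rightarrow> real"
  assumes "\<And>i. i \<in> I \<Longrightarrow> 0 \<le> a i \<and> a i \<le> 1"
  shows "\<bar>(\<Prod>i\<in>I. 1 - a i) - exp (- (\<Sum>i\<in>I. a i))\<bar> \<le> (\<Sum>i\<in>I. (a i)\<^sup>2)"
proof (cases "finite I")
  case True
  have *: "\<bar>1 - x - exp (- x)\<bar> \<le> x\<^sup>2" if "0 \<le> x" "x \<le> 1" for x :: real
  proof -
    have "1 + x \<le> exp x" by (rule exp_ge_add_one_self)
    then have "exp (- x) \<le> inverse (1 + x)"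
      using that by (simp only: exp_minus) (intro le_imp_inverse_le, auto)
    also have "\<dots> \<le> 1 - x + x\<^sup>2" using that
      by (simp add: field_simps power2_eq_square)
    finally have "exp (- x) \<le> 1 - x + x\<^sup>2" .
    moreover have "1 - x \<le> exp (- x)" using exp_ge_add_one_self[of "- x"] by simp
    ultimately show ?thesis by simp
  qed
  have "norm ((\<Prod>i\<in>I. 1 - a i) - (\<Prod>i\<in>I. exp (- a i))) \<le> (\<Sum>i\<in>I. norm (1 - a i - exp (- a i)))"
    using assms by (intro norm_prod_diff) auto
  also have "\<dots> \<le> (\<Sum>i\<in>I. (a i)\<^sup>2)" using assms * by (intro sum_mono) auto
  finally show ?thesis using True by (simp add: exp_sum sum_negf[symmetric])
qed simp

text \<open>The sum is cut at \<open>w\<close>. Below \<open>w\<close> a crude uniform bound loses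
  only a multiple of \<open>1 / K\<close>; above \<open>w\<close> the estimates at \<open>p\<close>
  are off by a factor of at most \<open>exp (12 / ln w)\<close> either way.\<close>

lemma sum_gap_prob_bounds:
  assumes "2 \<le> w" "w \<le> m" "K > 0"
  shows "exp (- 12 / ln w) * (ln (ln m) / K - (ln (ln w) + 11 / ln w) / K)
           \<le> (\<Sum>p\<in>primes_in 0 m. gap_prob K p)" (is ?low)
    and "(\<Sum>p\<in>primes_in 0 m. gap_prob K p)
           \<le> exp (11 / ln 2) * (\<Sum>p\<in>primes_in 0 w. 1 / p) / K
              + exp (12 / ln w) * (ln (ln m) / K + (11 / ln w - ln (ln w)) / K)" (is ?up)
proof -
  have split: "(\<Sum>p\<in>primes_in 0 m. gap_prob K p)
      = (\<Sum>p\<in>primes_in 0 w. gap_prob K p) + (\<Sum>p\<in>primes_in w m. gap_prob K p)"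
    using assms by (subst primes_in_split[of 0 w m]) (auto intro!: sum.union_disjoint simp: primes_in_def)
  have M: "\<bar>(\<Sum>p\<in>primes_in w m. 1 / p) - (ln (ln m) - ln (ln w))\<bar> \<le> 11 / ln w"
    using assms by (intro abs_sum_inverse_primes_diff_le) auto
  have p: "exp (- 12 / ln w) / K * (1 / p) \<le> gap_prob K p \<and> gap_prob K p \<le> exp (12 / ln w) / K * (1 / p)"
    if "p \<in> primes_in w m" for p
  proof -
    have p2: "p \<ge> 2" "w < p" using that primes_in_ge2 primes_inD by blast+
    have "12 / ln p \<le> 12 / ln w" using p2 assms by (intro divide_left_mono) auto
    then have "exp (- 12 / ln w) / (p * K) \<le> exp (- 12 / ln p) / (p * K)"
      by (intro divide_right_mono) auto
    with gap_prob_lower[of p K] p2 assms have 1: "exp (- 12 / ln w) / (p * K) \<le> gap_prob K p" by simp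
    have "11 / ln p \<le> 12 / ln w" using p2 assms by (intro frac_le) auto
    then have "exp (11 / ln p) / (p * K) \<le> exp (12 / ln w) / (p * K)"
      by (intro divide_right_mono) auto
    with gap_prob_upper[of p K] p2 assms have "gap_prob K p \<le> exp (12 / ln w) / (p * K)" by simp
    with 1 show ?thesis by (simp add: mult.commute)
  qed
  have "exp (- 12 / ln w) / K * (ln (ln m) - ln (ln w) - 11 / ln w)
      \<le> exp (- 12 / ln w) / K * (\<Sum>p\<in>primes_in w m. 1 / p)"
    using M by (intro mult_left_mono) auto
  also have "\<dots> \<le> (\<Sum>p\<in>primes_in w m. gap_prob K p)"
    unfolding sum_distrib_left using p by (intro sum_mono) auto
  also have "\<dots> \<le> (\<Sum>p\<in>primes_in 0 m. gap_prob K p)"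
    unfolding split using sum_nonneg[of "primes_in 0 w" "gap_prob K"] by (simp add: gap_prob_nonneg)
  finally show ?low by (simp add: diff_divide_distrib add_divide_distrib algebra_simps)
  have "(\<Sum>p\<in>primes_in 0 w. gap_prob K p) \<le> (\<Sum>p\<in>primes_in 0 w. exp (11 / ln 2) / K * (1 / p))"
    using gap_prob_uniform[of _ K] assms primes_in_ge2[of _ 0 w]
    by (intro sum_mono) (auto simp: mult.commute)
  then have 1: "(\<Sum>p\<in>primes_in 0 w. gap_prob K p) \<le> exp (11 / ln 2) * (\<Sum>p\<in>primes_in 0 w. 1 / p) / K"
    unfolding sum_distrib_left[symmetric] by simp
  have "(\<Sum>p\<in>primes_in w m. gap_prob K p) \<le> exp (12 / ln w) / K * (\<Sum>p\<in>primes_in w m. 1 / p)"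
    unfolding sum_distrib_left using p by (intro sum_mono) auto
  also have "\<dots> \<le> exp (12 / ln w) / K * (ln (ln m) - ln (ln w) + 11 / ln w)"
    using M by (intro mult_left_mono) auto
  finally show ?up using 1 split by (simp add: diff_divide_distrib add_divide_distrib algebra_simps)
qed

text \<open>Two nested limits: \<open>w\<close> is fixed first, large enough that
  \<open>exp (12 / ln w)\<close> or its inverse times \<open>L\<close> is still on the right side of
  \<open>a\<close>; then \<open>N\<close> grows and the terms with a constant numerator over
  \<open>K N\<close> vanish.\<close>

lemma sum_gap_prob_tendsto:
  fixes K m :: "nat \<Rightarrow> nat"
  assumes K: "filterlim K at_top sequentially" and m: "filterlim m at_top sequentially"
    and L: "(\<lambda>N. ln (ln (m N)) / K N) \<longlonglongrightarrow> L"
  shows "(\<lambda>N. \<Sum>p\<in>primes_in 0 (m N). gap_prob (K N) p) \<longlonglongrightarrow> L"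
proof (rule order_tendstoI)
  have Kpos: "eventually (\<lambda>N. K N > 0) sequentially"
    using K[unfolded filterlim_at_top, rule_format, of 1] by (simp add: Suc_le_eq)
  have mw: "eventually (\<lambda>N. w \<le> m N) sequentially" for w
    using m by (simp add: filterlim_at_top)
  have K0: "(\<lambda>N. C / real (K N)) \<longlonglongrightarrow> 0" for C :: real
    using filterlim_compose[OF filterlim_real_sequentially K]
    by (intro real_tendsto_divide_at_top) auto
  {
    fix a assume a: "a < L"
    have "((\<lambda>w::nat. exp (- 12 / ln (real w)) * L) \<longlonglongrightarrow> exp 0 * L)"
      by (intro tendsto_intros) real_asymp
    then have "eventually (\<lambda>w::nat. a < exp (- 12 / ln (real w)) * L) sequentially"
      using a by (intro order_tendstoD(1)) auto
    then obtain w where w: "w \<ge> (2::nat)" "a < exp (- 12 / ln (real w)) * L"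
      by (metis (no_types, lifting) eventually_sequentially linorder_linear)
    have "(\<lambda>N. exp (- 12 / ln w) * (ln (ln (m N)) / K N - (ln (ln w) + 11 / ln w) / K N))
        \<longlonglongrightarrow> exp (- 12 / ln w) * (L - 0)"
      by (intro tendsto_intros L K0)
    then have "eventually (\<lambda>N. a < exp (- 12 / ln w) * (ln (ln (m N)) / K N - (ln (ln w) + 11 / ln w) / K N)) sequentially"
      using w by (intro order_tendstoD(1)) auto
    then show "eventually (\<lambda>N. a < (\<Sum>p\<in>primes_in 0 (m N). gap_prob (K N) p)) sequentially"
      using Kpos mw[of w]
    proof eventually_elim
      case (elim N)
      then show ?case using sum_gap_prob_bounds(1)[of w "m N" "K N"] w by linarith
    qed
  }
  {
    fix a assume a: "L < a"
    have "((\<lambda>w::nat. exp (12 / ln (real w)) * L) \<longlonglongrightarrow> exp 0 * L)"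
      by (intro tendsto_intros) real_asymp
    then have "eventually (\<lambda>w::nat. exp (12 / ln (real w)) * L < a) sequentially"
      using a by (intro order_tendstoD(2)) auto
    then obtain w where w: "w \<ge> (2::nat)" "exp (12 / ln (real w)) * L < a"
      by (metis (no_types, lifting) eventually_sequentially linorder_linear)
    have "(\<lambda>N. exp (11 / ln 2) * (\<Sum>p\<in>primes_in 0 w. 1 / p) / K N
          + exp (12 / ln w) * (ln (ln (m N)) / K N + (11 / ln w - ln (ln w)) / K N))
        \<longlonglongrightarrow> 0 + exp (12 / ln w) * (L + 0)"
      by (intro tendsto_intros L K0)
    then have "eventually (\<lambda>N. exp (11 / ln 2) * (\<Sum>p\<in>primes_in 0 w. 1 / p) / K N
          + exp (12 / ln w) * (ln (ln (m N)) / K N + (11 / ln w - ln (ln w)) / K N) < a) sequentially"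
      using w by (intro order_tendstoD(2)) auto
    then show "eventually (\<lambda>N. (\<Sum>p\<in>primes_in 0 (m N). gap_prob (K N) p) < a) sequentially"
      using Kpos mw[of w]
    proof eventually_elim
      case (elim N)
      then show ?case using sum_gap_prob_bounds(2)[of w "m N" "K N"] w by linarith
    qed
  }
qed

lemma tendsto_of_abs_diff_le:
  fixes f g e :: "'a \<Rightarrow> real"
  assumes "eventually (\<lambda>x. \<bar>f x - g x\<bar> \<le> e x) F" "(e \<longlongrightarrow> 0) F" "(g \<longlongrightarrow> l) F"
  shows "(f \<longlongrightarrow> l) F"
proof -
  have "((\<lambda>x. f x - g x) \<longlongrightarrow> 0) F"
    by (rule tendsto_rabs_zero_cancel, rule tendsto_sandwich[OF _ assms(1) tendsto_const assms(2)]) simp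
  from tendsto_add[OF this assms(3)] show ?thesis by simp
qed

lemma no_gap_prob_tendsto:
  fixes K m y :: "nat \<Rightarrow> nat"
  assumes K: "filterlim K at_top sequentially" and m: "filterlim m at_top sequentially"
    and L: "(\<lambda>N. ln (ln (m N)) / K N) \<longlonglongrightarrow> L"
    and y: "eventually (\<lambda>N. m N ^ K N \<le> y N) sequentially"
  shows "(\<lambda>N. no_gap_prob (y N) (K N) (m N)) \<longlonglongrightarrow> exp (- L)"
proof -
  define S where "S = (\<lambda>N. \<Sum>p\<in>primes_in 0 (m N). gap_prob (K N) p)"
  have S: "S \<longlonglongrightarrow> L" unfolding S_def by (rule sum_gap_prob_tendsto[OF K m L])
  \<comment> \<open>The first summand is the dependence error of the recursion. The second bounds
    every gap probability, and so turns the sum of their squares into a multiple of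
    \<open>S\<close>.\<close>
  define d where "d = (\<lambda>k::nat. exp (11 / ln 2) * (ln k + 1 + 11 / ln 2) / k + exp (11 / ln 2) / k)"
  have "d \<longlonglongrightarrow> 0" unfolding d_def by real_asymp
  then have "(\<lambda>N. d (K N) * S N) \<longlonglongrightarrow> 0 * L"
    by (intro tendsto_mult S filterlim_compose[OF _ K])
  then have dS: "(\<lambda>N. d (K N) * S N) \<longlonglongrightarrow> 0" by simp
  have Kpos: "eventually (\<lambda>N. K N > 0) sequentially"
    using K[unfolded filterlim_at_top, rule_format, of 1] by (simp add: Suc_le_eq)
  have bound: "eventually (\<lambda>N. \<bar>(no_gap_prob (y N) (K N) (m N) - exp (- S N))\<bar> \<le> d (K N) * S N) sequentially"
    using y Kpos
  proof eventually_elim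
    case (elim N)
    let ?C = "exp (11 / ln 2) / K N"
    have sq: "(gap_prob (K N) p)\<^sup>2 \<le> ?C * gap_prob (K N) p" if "p \<in> primes_in 0 (m N)" for p
    proof -
      have p2: "p \<ge> 2" using that by (rule primes_in_ge2)
      have "gap_prob (K N) p \<le> exp (11 / ln 2) / (p * K N)"
        using p2 elim gap_prob_uniform[of p "K N"] by simp
      also have "\<dots> \<le> ?C" using p2 elim by (intro divide_left_mono) auto
      finally show ?thesis
        unfolding power2_eq_square by (intro mult_right_mono) (auto simp: gap_prob_nonneg)
    qed
    have "\<bar>no_gap_prob (y N) (K N) (m N) - (\<Prod>p\<in>primes_in 0 (m N). 1 - gap_prob (K N) p)\<bar>
        \<le> exp (11 / ln 2) * (ln (K N) + 1 + 11 / ln 2) / K N * S N"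
      unfolding S_def by (rule abs_no_gap_prob_diff_le) (use elim in auto)
    moreover have "\<bar>(\<Prod>p\<in>primes_in 0 (m N). 1 - gap_prob (K N) p) - exp (- S N)\<bar>
        \<le> (\<Sum>p\<in>primes_in 0 (m N). (gap_prob (K N) p)\<^sup>2)"
      unfolding S_def
      by (rule abs_prod_one_minus_diff_exp_le) (simp add: gap_prob_nonneg gap_prob_le_1)
    moreover have "\<dots> \<le> ?C * S N"
      unfolding S_def sum_distrib_left by (intro sum_mono sq)
    ultimately show ?case unfolding d_def by (simp add: distrib_right)
  qed
  have "(\<lambda>N. exp (- S N)) \<longlonglongrightarrow> exp (- L)" by (intro tendsto_intros S)
  with bound dS show ?thesis by (rule tendsto_of_abs_diff_le)
qed

section \<open>Transfer from the model to the integers\<close>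

text \<open>Truncated inclusion-exclusion: the expansion of the product of \<open>1 - w p\<close>
  over \<open>Q\<close>, cut after the subsets of \<open>r\<close> elements.\<close>

definition bonferroni_sum :: "('a \<Rightarrow> real) \<Rightarrow> 'a set \<Rightarrow> nat \<Rightarrow> real" where
  "bonferroni_sum w Q r = (\<Sum>D | D \<subseteq> Q \<and> card D \<le> r. (- 1) ^ card D * prod w D)"

lemma bonferroni_sum_insert:
  assumes "finite Q" "q \<notin> Q"
  shows "bonferroni_sum w (insert q Q) (Suc r) = bonferroni_sum w Q (Suc r) - w q * bonferroni_sum w Q r"
proof -
  let ?A = "{D. D \<subseteq> Q \<and> card D \<le> Suc r}" and ?B = "{D. D \<subseteq> Q \<and> card D \<le> r}"
  have card: "card (insert q D) = Suc (card D)" if "D \<subseteq> Q" for D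
    using that assms by (subst card_insert_disjoint) (auto intro: finite_subset)
  have "{D. D \<subseteq> insert q Q \<and> card D \<le> Suc r} = ?A \<union> insert q ` ?B"
  proof (intro equalityI subsetI)
    fix D assume D: "D \<in> {D. D \<subseteq> insert q Q \<and> card D \<le> Suc r}"
    show "D \<in> ?A \<union> insert q ` ?B"
    proof (cases "q \<in> D")
      case True
      then have "D = insert q (D - {q})" "D - {q} \<subseteq> Q" using D by auto
      moreover from this have "card (D - {q}) \<le> r" using D card[of "D - {q}"] by auto
      ultimately show ?thesis by blast
    qed (use D in auto)
  qed (use card in \<open>auto\<close>)
  moreover have "?A \<inter> insert q ` ?B = {}" using assms by auto
  ultimately have "bonferroni_sum w (insert q Q) (Suc r)
      = bonferroni_sum w Q (Suc r) + (\<Sum>D\<in>insert q ` ?B. (- 1) ^ card D * prod w D)"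
    unfolding bonferroni_sum_def using assms by (simp add: sum.union_disjoint)
  also have "(\<Sum>D\<in>insert q ` ?B. (- 1) ^ card D * prod w D)
      = (\<Sum>D\<in>?B. (- 1) ^ card (insert q D) * prod w (insert q D))"
    using assms by (subst sum.reindex) (auto simp: inj_on_def)
  also have "\<dots> = (\<Sum>D\<in>?B. - w q * ((- 1) ^ card D * prod w D))"
  proof (intro sum.cong refl)
    fix D assume D: "D \<in> ?B"
    then have "prod w (insert q D) = w q * prod w D"
      using assms by (subst prod.insert) (auto intro: finite_subset)
    with D show "(- 1) ^ card (insert q D) * prod w (insert q D) = - w q * ((- 1) ^ card D * prod w D)"
      by (simp add: card)
  qed
  also have "\<dots> = - w q * bonferroni_sum w Q r"
    by (simp add: bonferroni_sum_def sum_distrib_left)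
  finally show ?thesis by simp
qed

lemma bonferroni_sum_0:
  assumes "finite Q"
  shows "bonferroni_sum w Q 0 = 1"
proof -
  have "{D. D \<subseteq> Q \<and> card D \<le> 0} = {{}}"
    using finite_subset[OF _ assms] by auto
  then show ?thesis by (simp add: bonferroni_sum_def)
qed

text \<open>Stated for arbitrary weights in the unit interval: it is applied both to \<open>1 / p\<close> and to the
  indicator of \<open>p dvd n\<close>.\<close>

lemma bonferroni_inequalities:
  assumes "finite Q" "\<And>p. p \<in> Q \<Longrightarrow> 0 \<le> w p \<and> w p \<le> 1"
  shows "(even r \<longrightarrow> (\<Prod>p\<in>Q. 1 - w p) \<le> bonferroni_sum w Q r) \<and>
         (odd r \<longrightarrow> bonferroni_sum w Q r \<le> (\<Prod>p\<in>Q. 1 - w p))"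
  using assms
proof (induction Q arbitrary: r rule: finite_induct)
  case empty
  have "{D. D \<subseteq> {} \<and> card D \<le> r} = {{}::'a set}" by auto
  then show ?case by (simp add: bonferroni_sum_def)
next
  case (insert q Q)
  have w: "0 \<le> w q" "w q \<le> 1" using insert.prems by auto
  have IH: "(even r \<longrightarrow> (\<Prod>p\<in>Q. 1 - w p) \<le> bonferroni_sum w Q r) \<and>
         (odd r \<longrightarrow> bonferroni_sum w Q r \<le> (\<Prod>p\<in>Q. 1 - w p))" for r
    using insert by blast
  show ?case
  proof (cases r)
    case 0
    have "(\<Prod>p\<in>insert q Q. 1 - w p) \<le> 1" using insert.prems by (intro prod_le_1) auto
    with 0 insert.hyps show ?thesis by (simp add: bonferroni_sum_0)
  next
    case (Suc s)
    have P: "(\<Prod>p\<in>insert q Q. 1 - w p) = (\<Prod>p\<in>Q. 1 - w p) - w q * (\<Prod>p\<in>Q. 1 - w p)"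
      using insert.hyps by (simp add: algebra_simps)
    \<comment> \<open>\<open>s\<close> and \<open>Suc s\<close> have opposite parity, so the
      subtracted sum errs in the direction opposite to the first one, and both errors have the same
      effect.\<close>
    show ?thesis
      unfolding Suc bonferroni_sum_insert[OF insert.hyps] P
      using IH[of s] IH[of "Suc s"] mult_left_mono[OF _ w(1)] by (auto intro!: diff_mono)
  qed
qed

lemma sum_subsets_prod_le_exp:
  assumes "finite P" "\<And>p. p \<in> P \<Longrightarrow> 0 \<le> w p"
  shows "(\<Sum>D\<in>Pow P. prod w D) \<le> exp (\<Sum>p\<in>P. w p :: real)"
proof -
  have "(\<Sum>D\<in>Pow P. prod w D) = (\<Prod>p\<in>P. w p + 1)" using prod_add[OF assms(1), of w "\<lambda>_. 1"] by simp
  also have "\<dots> \<le> (\<Prod>p\<in>P. exp (w p))"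
    using exp_ge_add_one_self assms(2) by (intro prod_mono) (auto simp: add.commute)
  also have "\<dots> = exp (\<Sum>p\<in>P. w p)" using assms by (simp add: exp_sum)
  finally show ?thesis .
qed

text \<open>Rankin's trick: the factor \<open>b ^ card D / b ^ r\<close> is at least 1 on the
  subsets in question, and with this factor the sum over all subsets becomes a product.\<close>

lemma sum_large_subsets_le:
  fixes b :: real
  assumes "finite P" "\<And>p. p \<in> P \<Longrightarrow> 0 \<le> w p" "b \<ge> 1"
  shows "(\<Sum>D | D \<subseteq> P \<and> r < card D. prod w D) \<le> exp (b * (\<Sum>p\<in>P. w p)) / b ^ r"
proof -
  have nn: "0 \<le> prod w D" if "D \<subseteq> P" for D using that assms(2) by (intro prod_nonneg) auto
  have scale: "(\<Prod>p\<in>D. b * w p) = b ^ card D * prod w D" for D by (simp add: prod.distrib)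
  have "(\<Sum>D | D \<subseteq> P \<and> r < card D. prod w D) \<le> (\<Sum>D | D \<subseteq> P \<and> r < card D. (\<Prod>p\<in>D. b * w p) / b ^ r)"
  proof (intro sum_mono)
    fix D assume D: "D \<in> {D. D \<subseteq> P \<and> r < card D}"
    have "b ^ r \<le> b ^ card D" using D assms(3) by (intro power_increasing) auto
    then have "b ^ r * prod w D \<le> (\<Prod>p\<in>D. b * w p)"
      unfolding scale using nn D by (intro mult_right_mono) auto
    then show "prod w D \<le> (\<Prod>p\<in>D. b * w p) / b ^ r" using assms(3) by (simp add: field_simps)
  qed
  also have "\<dots> \<le> (\<Sum>D\<in>Pow P. (\<Prod>p\<in>D. b * w p) / b ^ r)"
    using assms nn by (intro sum_mono2) (auto simp: scale)
  also have "\<dots> = (\<Sum>D\<in>Pow P. (\<Prod>p\<in>D. b * w p)) / b ^ r" by (simp add: sum_divide_distrib)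
  also have "\<dots> \<le> exp (\<Sum>p\<in>P. b * w p) / b ^ r"
    using assms by (intro divide_right_mono sum_subsets_prod_le_exp) auto
  finally show ?thesis by (simp add: sum_distrib_left)
qed

text \<open>The truncation at \<open>Suc r\<close> lies above the product and differs from the one
  at \<open>r\<close> only by the subsets of \<open>Suc r\<close> elements, which enter with
  positive sign.\<close>

lemma bonferroni_sum_odd_ge:
  assumes "finite Q" "\<And>p. p \<in> Q \<Longrightarrow> 0 \<le> w p \<and> w p \<le> 1" "odd r"
  shows "(\<Prod>p\<in>Q. 1 - w p) - (\<Sum>D | D \<subseteq> Q \<and> r < card D. prod w D) \<le> bonferroni_sum w Q r"
proof -
  let ?A = "{D. D \<subseteq> Q \<and> card D \<le> r}" and ?B = "{D. D \<subseteq> Q \<and> card D = Suc r}"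
  have "{D. D \<subseteq> Q \<and> card D \<le> Suc r} = ?A \<union> ?B" by auto
  then have "bonferroni_sum w Q (Suc r) = bonferroni_sum w Q r + (\<Sum>D\<in>?B. (- 1) ^ card D * prod w D)"
    unfolding bonferroni_sum_def using assms by (simp add: sum.union_disjoint disjoint_iff)
  also have "(\<Sum>D\<in>?B. (- 1) ^ card D * prod w D) = (\<Sum>D\<in>?B. prod w D)"
    using assms(3) by (intro sum.cong) auto
  also have "\<dots> \<le> (\<Sum>D | D \<subseteq> Q \<and> r < card D. prod w D)"
    using assms by (intro sum_mono2) (auto intro!: prod_nonneg)
  finally show ?thesis
    using bonferroni_inequalities[of Q w "Suc r"] assms by auto
qed

section \<open>Sieving for the exact set of small prime factors\<close>

definition small_primes_of :: "nat \<Rightarrow> nat \<Rightarrow> nat set" where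
  "small_primes_of y n = {p\<in>primes_in 0 y. p dvd n}"

lemma prod_of_bool:
  assumes "finite D"
  shows "(\<Prod>p\<in>D. of_bool (R p) :: real) = of_bool (\<forall>p\<in>D. R p)"
  using assms by (induction D rule: finite_induct) auto

text \<open>The lower Bonferroni inequality, applied for each \<open>n\<close> to the indicators of
  \<open>p dvd n\<close>, reduces the count to multiples of \<open>\<Prod>S * \<Prod>D\<close>.
  Replacing \<open>N div d\<close> by \<open>N / d\<close> costs at most 1 for each
  \<open>D\<close>, whatever its sign.\<close>

lemma card_small_primes_of_ge:
  assumes S: "S \<subseteq> primes_in 0 y" and r: "odd r"
  defines "Q \<equiv> primes_in 0 y - S"
  shows "real N * prod (\<lambda>p. 1 / real p) S * bonferroni_sum (\<lambda>p. 1 / real p) Q r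
           - real (card {D. D \<subseteq> Q \<and> card D \<le> r}) \<le> real (card {n\<in>{1..N}. small_primes_of y n = S})"
proof -
  have fin: "finite S" "finite Q" using finite_subset[OF S] by (auto simp: Q_def)
  let ?I = "\<lambda>n p. of_bool (p dvd n) :: real" and ?B = "{D. D \<subseteq> Q \<and> card D \<le> r}"
  have finB: "finite ?B" using fin by auto
  have eq: "small_primes_of y n = S \<longleftrightarrow> (\<forall>p\<in>S. p dvd n) \<and> (\<forall>p\<in>Q. \<not> p dvd n)" for n
    using S by (auto simp: small_primes_of_def Q_def)
  have pos: "\<Prod>D > 0" if "D \<subseteq> primes_in 0 y" for D
    using that by (intro prod_pos) (auto simp: primes_in_def prime_gt_0_nat)
  have inner: "(\<Sum>n=1..N. prod (?I n) S * prod (?I n) D) = real (N div (\<Prod>S * \<Prod>D))" if D: "D \<in> ?B" for D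
  proof -
    have finD: "finite D" using D fin finite_subset by auto
    have SD: "S \<union> D \<subseteq> primes_in 0 y" "S \<inter> D = {}" using S D by (auto simp: Q_def)
    have prime: "prime p" if "p \<in> S \<union> D" for p using that SD primes_inD by blast
    have un: "\<Prod>(S \<union> D) = \<Prod>S * \<Prod>D" using fin finD SD by (intro prod.union_disjoint) auto
    have "(\<forall>p\<in>S. p dvd n) \<and> (\<forall>p\<in>D. p dvd n) \<longleftrightarrow> \<Prod>S * \<Prod>D dvd n" for n
    proof -
      have "\<Prod>(S \<union> D) dvd n" if "\<forall>p\<in>S \<union> D. p dvd n"
        using that prime fin finD by (intro prod_primes_dvd) auto
      moreover have "p dvd n" if "\<Prod>(S \<union> D) dvd n" "p \<in> S \<union> D" for p
        using that fin finD dvd_prodI[of "S \<union> D" p "\<lambda>p. p"] dvd_trans by auto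
      ultimately show ?thesis unfolding un by blast
    qed
    then have "(\<Sum>n=1..N. prod (?I n) S * prod (?I n) D) = (\<Sum>n=1..N. of_bool (\<Prod>S * \<Prod>D dvd n))"
      using fin finD by (intro sum.cong) (auto simp: prod_of_bool)
    also have "\<dots> = real (card {n\<in>{1..N}. \<Prod>S * \<Prod>D dvd n})"
      by (simp add: sum_of_bool_eq Int_def)
    also have "\<dots> = real (N div (\<Prod>S * \<Prod>D))"
      using pos[of S] pos[of D] SD by (subst card_multiples) auto
    finally show ?thesis .
  qed
  have "real N * prod (\<lambda>p. 1 / real p) S * bonferroni_sum (\<lambda>p. 1 / real p) Q r - real (card ?B)
      = (\<Sum>D\<in>?B. (- 1) ^ card D * (real N / real (\<Prod>S * \<Prod>D)) - 1)"
    by (simp add: bonferroni_sum_def sum_distrib_left sum_subtractf prod_dividef mult_ac)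
  also have "\<dots> \<le> (\<Sum>D\<in>?B. (- 1) ^ card D * real (N div (\<Prod>S * \<Prod>D)))"
  proof (intro sum_mono)
    fix D assume "D \<in> ?B"
    show "(- 1) ^ card D * (real N / real (\<Prod>S * \<Prod>D)) - 1 \<le> (- 1) ^ card D * real (N div (\<Prod>S * \<Prod>D))"
      using real_div_ge[of N "\<Prod>S * \<Prod>D"] of_nat_div_le_of_nat[of N "\<Prod>S * \<Prod>D", where ?'a = real]
      by (cases "even (card D)") auto
  qed
  also have "\<dots> = (\<Sum>D\<in>?B. \<Sum>n=1..N. (- 1) ^ card D * (prod (?I n) S * prod (?I n) D))"
    by (intro sum.cong refl) (simp only: inner[symmetric] sum_distrib_left)
  also have "\<dots> = (\<Sum>n=1..N. prod (?I n) S * bonferroni_sum (?I n) Q r)"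
    unfolding bonferroni_sum_def sum_distrib_left by (subst sum.swap) (simp add: mult_ac)
  also have "\<dots> \<le> (\<Sum>n=1..N. prod (?I n) S * (\<Prod>p\<in>Q. 1 - ?I n p))"
    using bonferroni_inequalities[OF fin(2), of "?I _" r] r
    by (intro sum_mono mult_left_mono) (auto intro!: prod_nonneg)
  also have "\<dots> = (\<Sum>n=1..N. of_bool (small_primes_of y n = S))"
  proof (intro sum.cong refl)
    fix n
    have "(\<Prod>p\<in>Q. 1 - ?I n p) = (\<Prod>p\<in>Q. of_bool (\<not> p dvd n))" by (intro prod.cong) auto
    then show "prod (?I n) S * (\<Prod>p\<in>Q. 1 - ?I n p) = of_bool (small_primes_of y n = S)"
      using fin by (simp add: prod_of_bool eq)
  qed
  also have "\<dots> = real (card {n\<in>{1..N}. small_primes_of y n = S})"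
    by (simp add: sum_of_bool_eq Int_def)
  finally show ?thesis .
qed

text \<open>At most \<open>r\<close> primes up to \<open>y\<close> have product at most
  \<open>y ^ r\<close>, so each such \<open>D\<close> is counted at least once by the weight
  \<open>y ^ r\<close> times the product of the reciprocals.\<close>

lemma card_small_subsets_le:
  fixes y :: nat
  assumes "y > 0"
  defines "\<sigma> \<equiv> (\<Sum>p\<in>primes_in 0 y. 1 / real p)"
  shows "real (card {D. D \<subseteq> primes_in 0 y \<and> card D \<le> r}) \<le> real y ^ r * exp \<sigma>"
proof -
  let ?P = "primes_in 0 y" and ?w = "\<lambda>p. 1 / real p"
  have fin: "finite {D. D \<subseteq> ?P \<and> card D \<le> r}" by (rule finite_subset[of _ "Pow ?P"]) auto
  have "1 \<le> real y ^ r * prod ?w D" if D: "D \<subseteq> ?P" "card D \<le> r" for D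
  proof -
    have "(\<Prod>p\<in>D. real p) \<le> (\<Prod>p\<in>D. real y)"
      using D by (intro prod_mono) (auto simp: primes_in_def)
    also have "\<dots> \<le> real y ^ r" using D assms by (simp add: power_increasing)
    finally have "(\<Prod>p\<in>D. real p) \<le> real y ^ r" .
    moreover have "(\<Prod>p\<in>D. real p) > 0" using D by (intro prod_pos) (auto simp: primes_in_def prime_gt_0_nat)
    ultimately show ?thesis by (simp add: prod_dividef)
  qed
  then have "(\<Sum>D | D \<subseteq> ?P \<and> card D \<le> r. 1) \<le> (\<Sum>D | D \<subseteq> ?P \<and> card D \<le> r. real y ^ r * prod ?w D)"
    by (intro sum_mono) auto
  also have "\<dots> \<le> (\<Sum>D\<in>Pow ?P. real y ^ r * prod ?w D)"
    by (intro sum_mono2) (auto intro!: mult_nonneg_nonneg prod_nonneg)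
  also have "\<dots> \<le> real y ^ r * exp \<sigma>"
    unfolding sum_distrib_left[symmetric] \<sigma>_def by (intro mult_left_mono sum_subsets_prod_le_exp) auto
  finally show ?thesis by simp
qed

text \<open>The factor \<open>prod w S\<close> is kept on the truncation error so that summation
  over \<open>S\<close> will cost only a factor \<open>exp \<sigma>\<close>. The base 8 is Rankin's
  parameter.\<close>

lemma bern_weight_small_primes_of_diff_le:
  fixes y N :: nat
  assumes S: "S \<subseteq> primes_in 0 y" and r: "odd r" and y: "y > 0" and N: "N > 0"
  defines "\<sigma> \<equiv> (\<Sum>p\<in>primes_in 0 y. 1 / real p)" and "w \<equiv> (\<lambda>p. 1 / real p)"
  shows "bern_weight w (primes_in 0 y) S - real (card {n\<in>{1..N}. small_primes_of y n = S}) / real N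
           \<le> prod w S * (exp (8 * \<sigma>) / 8 ^ r) + real y ^ r * exp \<sigma> / N"
proof -
  let ?P = "primes_in 0 y"
  define Q where "Q = ?P - S"
  have wS: "0 \<le> prod w S" by (auto simp: w_def intro!: prod_nonneg)
  have finQ: "finite Q" "Q \<subseteq> ?P" by (auto simp: Q_def)
  have w01: "0 \<le> w p \<and> w p \<le> 1" if "p \<in> Q" for p using that prime_weights by (auto simp: Q_def w_def)
  have "(\<Sum>D | D \<subseteq> Q \<and> r < card D. prod w D) \<le> (\<Sum>D | D \<subseteq> ?P \<and> r < card D. prod w D)"
    using finQ by (intro sum_mono2) (auto simp: w_def intro!: prod_nonneg)
  also have "\<dots> \<le> exp (8 * \<sigma>) / 8 ^ r"
    unfolding \<sigma>_def w_def by (intro sum_large_subsets_le) auto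
  finally have tail: "(\<Prod>p\<in>Q. 1 - w p) - exp (8 * \<sigma>) / 8 ^ r \<le> bonferroni_sum w Q r"
    using bonferroni_sum_odd_ge[of Q w r] finQ w01 r by auto
  have "card {D. D \<subseteq> Q \<and> card D \<le> r} \<le> card {D. D \<subseteq> ?P \<and> card D \<le> r}"
    using finQ by (intro card_mono) auto
  then have cnt: "real (card {D. D \<subseteq> Q \<and> card D \<le> r}) \<le> real y ^ r * exp \<sigma>"
    using card_small_subsets_le[OF y, of r] unfolding \<sigma>_def by linarith
  have "real N * prod w S * ((\<Prod>p\<in>Q. 1 - w p) - exp (8 * \<sigma>) / 8 ^ r)
      \<le> real N * prod w S * bonferroni_sum w Q r"
    using wS tail by (intro mult_left_mono) auto
  then have "real N * prod w S * ((\<Prod>p\<in>Q. 1 - w p) - exp (8 * \<sigma>) / 8 ^ r) - real y ^ r * exp \<sigma>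
      \<le> real (card {n\<in>{1..N}. small_primes_of y n = S})"
    using card_small_primes_of_ge[OF S r, of N] cnt unfolding w_def Q_def by linarith
  then have "(real N * prod w S * ((\<Prod>p\<in>Q. 1 - w p) - exp (8 * \<sigma>) / 8 ^ r) - real y ^ r * exp \<sigma>) / N
      \<le> real (card {n\<in>{1..N}. small_primes_of y n = S}) / N"
    by (intro divide_right_mono) auto
  then show ?thesis using N unfolding bern_weight_def Q_def
    by (simp add: diff_divide_distrib right_diff_distrib)
qed

text \<open>For \<open>S\<close> with more than \<open>r\<close> elements the count is only used to
  be nonnegative, and Rankin's trick bounds the model weight. Summing over the other
  \<open>S\<close> multiplies the truncation error by at most \<open>exp \<sigma>\<close>, whence
  \<open>9 * \<sigma>\<close>, and the rounding error by the number of such \<open>S\<close>, whence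
  the exponent \<open>2 * r\<close>.\<close>

lemma prime_model_minus_density_le:
  fixes y N :: nat
  assumes r: "odd r" and y: "y > 0" and N: "N > 0"
  defines "\<sigma> \<equiv> (\<Sum>p\<in>primes_in 0 y. 1 / real p)"
  shows "prime_model y E - real (card {n\<in>{1..N}. E (small_primes_of y n)}) / real N
           \<le> 2 * exp (9 * \<sigma>) / 8 ^ r + real y ^ (2 * r) * exp (2 * \<sigma>) / N"
proof -
  let ?P = "primes_in 0 y"
  define w where "w = (\<lambda>p::nat. 1 / real p)"
  define c where "c = (\<lambda>S. real (card {n\<in>{1..N}. small_primes_of y n = S}))"
  define A where "A = exp (8 * \<sigma>) / 8 ^ r"
  define B where "B = real y ^ r * exp \<sigma> / N"
  have AB: "0 \<le> A" "0 \<le> B" by (auto simp: A_def B_def)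
  have wS: "0 \<le> prod w S" for S by (auto simp: w_def intro!: prod_nonneg)
  have \<sigma>: "\<sigma> \<ge> 0" by (auto simp: \<sigma>_def intro!: sum_nonneg)
  define t where "t = (\<lambda>S. if card S \<le> r then prod w S * A + B else prod w S)"
  let ?T = "{S. S \<subseteq> ?P \<and> E S}"
  have finT: "finite ?T" by simp
  have "real (card {n\<in>{1..N}. E (small_primes_of y n)})
      = (\<Sum>S\<in>?T. \<Sum>n\<in>{n\<in>{n\<in>{1..N}. E (small_primes_of y n)}. small_primes_of y n = S}. 1)"
    by (subst sum.group) (auto simp: small_primes_of_def)
  also have "\<dots> = (\<Sum>S\<in>?T. c S)"
    unfolding c_def by (intro sum.cong refl) (auto intro!: arg_cong[of _ _ card])
  finally have cnt: "real (card {n\<in>{1..N}. E (small_primes_of y n)}) / N = (\<Sum>S\<in>?T. c S / N)"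
    by (simp add: sum_divide_distrib)
  have "prime_model y E - real (card {n\<in>{1..N}. E (small_primes_of y n)}) / real N
      = (\<Sum>S\<in>?T. bern_weight w ?P S - c S / N)"
    unfolding cnt by (simp add: bern_prob_def w_def sum_subtractf)
  also have "\<dots> \<le> (\<Sum>S\<in>?T. t S)"
  proof (intro sum_mono)
    fix S assume S: "S \<in> ?T"
    show "bern_weight w ?P S - c S / N \<le> t S"
    proof (cases "card S \<le> r")
      case True
      then show ?thesis
        using bern_weight_small_primes_of_diff_le[of S y r N] S r y N
        by (simp add: t_def A_def B_def c_def w_def \<sigma>_def)
    next
      case False
      have "(\<Prod>p\<in>?P - S. 1 - w p) \<le> 1"
        using prime_weights by (intro prod_le_1) (auto simp: w_def)
      then have "bern_weight w ?P S \<le> prod w S"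
        unfolding bern_weight_def using wS by (simp add: mult_left_le)
      moreover have "0 \<le> c S / N" by (simp add: c_def)
      ultimately show ?thesis using False by (simp add: t_def)
    qed
  qed
  also have "\<dots> \<le> (\<Sum>S\<in>Pow ?P. t S)"
    using AB wS by (intro sum_mono2) (auto simp: t_def)
  also have "\<dots> = (\<Sum>S | S \<subseteq> ?P \<and> card S \<le> r. prod w S * A + B) + (\<Sum>S | S \<subseteq> ?P \<and> r < card S. prod w S)"
  proof -
    have "Pow ?P = {S. S \<subseteq> ?P \<and> card S \<le> r} \<union> {S. S \<subseteq> ?P \<and> r < card S}" by auto
    then have "(\<Sum>S\<in>Pow ?P. t S) = (\<Sum>S | S \<subseteq> ?P \<and> card S \<le> r. t S) + (\<Sum>S | S \<subseteq> ?P \<and> r < card S. t S)"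
      by (simp add: sum.union_disjoint disjoint_iff)
    also have "\<dots> = (\<Sum>S | S \<subseteq> ?P \<and> card S \<le> r. prod w S * A + B) + (\<Sum>S | S \<subseteq> ?P \<and> r < card S. prod w S)"
      by (intro arg_cong2[of _ _ _ _ "(+)"] sum.cong) (auto simp: t_def)
    finally show ?thesis .
  qed
  also have "(\<Sum>S | S \<subseteq> ?P \<and> r < card S. prod w S) \<le> A"
    unfolding A_def \<sigma>_def w_def by (intro sum_large_subsets_le) auto
  also have "(\<Sum>S | S \<subseteq> ?P \<and> card S \<le> r. prod w S * A + B)
      = (\<Sum>S | S \<subseteq> ?P \<and> card S \<le> r. prod w S) * A + real (card {S. S \<subseteq> ?P \<and> card S \<le> r}) * B"
    by (simp add: sum.distrib sum_distrib_right)
  also have "\<dots> \<le> exp \<sigma> * A + (real y ^ r * exp \<sigma>) * B"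
  proof (intro add_mono mult_right_mono AB)
    have "(\<Sum>S | S \<subseteq> ?P \<and> card S \<le> r. prod w S) \<le> (\<Sum>S\<in>Pow ?P. prod w S)"
      using wS by (intro sum_mono2) auto
    also have "\<dots> \<le> exp \<sigma>" unfolding \<sigma>_def w_def by (intro sum_subsets_prod_le_exp) auto
    finally show "(\<Sum>S | S \<subseteq> ?P \<and> card S \<le> r. prod w S) \<le> exp \<sigma>" .
    show "real (card {S. S \<subseteq> ?P \<and> card S \<le> r}) \<le> real y ^ r * exp \<sigma>"
      unfolding \<sigma>_def by (rule card_small_subsets_le[OF y])
  qed
  also have "exp \<sigma> * A = exp (9 * \<sigma>) / 8 ^ r" by (simp add: A_def flip: exp_add)
  also have "(real y ^ r * exp \<sigma>) * B = real y ^ (2 * r) * exp (2 * \<sigma>) / N"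
    unfolding mult_2 power_add exp_add by (simp add: B_def mult_ac)
  also have "A \<le> exp (9 * \<sigma>) / 8 ^ r" unfolding A_def using \<sigma> by (intro divide_right_mono) auto
  finally show ?thesis by simp
qed

text \<open>The one-sided bound holds for every event; applied to the complement it yields the other
  side, since both total masses are 1.\<close>

lemma abs_prime_model_minus_density_le:
  fixes y N :: nat
  assumes "odd r" "y > 0" "N > 0"
  defines "\<sigma> \<equiv> (\<Sum>p\<in>primes_in 0 y. 1 / real p)"
  shows "\<bar>prime_model y E - real (card {n\<in>{1..N}. E (small_primes_of y n)}) / real N\<bar>
           \<le> 2 * exp (9 * \<sigma>) / 8 ^ r + real y ^ (2 * r) * exp (2 * \<sigma>) / N"
proof -
  let ?E = "\<lambda>S. \<not> E S"
  have "prime_model y (\<lambda>S. E S \<or> ?E S) = prime_model y E + prime_model y ?E"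
    by (rule bern_prob_disj_eq) auto
  then have 1: "prime_model y ?E = 1 - prime_model y E" by (simp add: bern_prob_True)
  have "{n\<in>{1..N}. E (small_primes_of y n)} \<union> {n\<in>{1..N}. ?E (small_primes_of y n)} = {1..N}" by auto
  moreover have "card ({n\<in>{1..N}. E (small_primes_of y n)} \<union> {n\<in>{1..N}. ?E (small_primes_of y n)})
      = card {n\<in>{1..N}. E (small_primes_of y n)} + card {n\<in>{1..N}. ?E (small_primes_of y n)}"
    by (rule card_Un_disjoint) auto
  ultimately have "real (card {n\<in>{1..N}. ?E (small_primes_of y n)})
      = real N - real (card {n\<in>{1..N}. E (small_primes_of y n)})" by simp
  then have 2: "real (card {n\<in>{1..N}. ?E (small_primes_of y n)}) / N
      = 1 - real (card {n\<in>{1..N}. E (small_primes_of y n)}) / N"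
    using assms by (simp add: diff_divide_distrib)
  show ?thesis
    using prime_model_minus_density_le[OF assms(1-3), of E] prime_model_minus_density_le[OF assms(1-3), of ?E] 1 2
    unfolding \<sigma>_def by linarith
qed

section \<open>Gaps between large prime factors\<close>

definition prime_free :: "nat \<Rightarrow> nat \<Rightarrow> nat \<Rightarrow> nat set" where
  "prime_free N u v = {n\<in>{1..N}. \<forall>p\<in>primes_in u v. \<not> p dvd n}"

text \<open>Turan's second moment argument; the bound needs no condition on \<open>v\<close> beyond \<open>v \<le> N\<close> because
  the second moment is only estimated from above.\<close>

lemma card_prime_free_le:
  fixes u v N :: nat
  assumes "v \<le> N"
  defines "s \<equiv> (\<Sum>p\<in>primes_in u v. 1 / real p)"
  assumes s: "s > 0"
  shows "real (card (prime_free N u v)) \<le> 3 * N / s"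
proof -
  let ?Q = "primes_in u v"
  define om where "om = (\<lambda>n. \<Sum>p\<in>?Q. of_bool (p dvd n) :: real)"
  have count: "(\<Sum>n=1..N. of_bool (d dvd n) :: real) = real (N div d)" if "d > 0" for d
    using card_multiples[OF that, of N] by (simp add: sum_of_bool_eq Int_def)
  have Qpos: "p > 0" if "p \<in> ?Q" for p using that primes_inD(2)[OF that] by simp
  have "card ?Q \<le> card {1..v}" by (intro card_mono) (auto simp: primes_in_def)
  then have cQ: "real (card ?Q) \<le> N" using assms(1) by simp
  have "(\<Sum>n=1..N. om n) = (\<Sum>p\<in>?Q. \<Sum>n=1..N. of_bool (p dvd n))"
    unfolding om_def by (rule sum.swap)
  also have "\<dots> = (\<Sum>p\<in>?Q. real (N div p))" by (intro sum.cong refl count Qpos)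
  also have "\<dots> \<ge> (\<Sum>p\<in>?Q. N / p - 1)" by (intro sum_mono real_div_ge)
  also have "(\<Sum>p\<in>?Q. N / p - 1) = N * s - card ?Q"
    by (simp add: s_def sum_subtractf sum_distrib_left)
  finally have first: "N * s - N \<le> (\<Sum>n=1..N. om n)" using cQ by linarith
  have "(\<Sum>n=1..N. (om n)\<^sup>2) = (\<Sum>n=1..N. \<Sum>p\<in>?Q. \<Sum>q\<in>?Q. of_bool (p dvd n) * of_bool (q dvd n))"
    unfolding om_def power2_eq_square sum_product ..
  also have "\<dots> = (\<Sum>p\<in>?Q. \<Sum>q\<in>?Q. \<Sum>n=1..N. of_bool (p dvd n) * of_bool (q dvd n))"
    by (subst sum.swap, intro sum.cong refl sum.swap)
  \<comment> \<open>The term \<open>N / (p q)\<close> is also granted on the diagonal, so that the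
    double sum factors as \<open>N * s\<close> times \<open>s\<close>.\<close>
  also have "\<dots> \<le> (\<Sum>p\<in>?Q. \<Sum>q\<in>?Q. (if p = q then N / p else 0) + N * ((1 / p) * (1 / q)))"
  proof (intro sum_mono)
    fix p q assume p: "p \<in> ?Q" and q: "q \<in> ?Q"
    show "(\<Sum>n=1..N. of_bool (p dvd n) * of_bool (q dvd n)) \<le> (if p = q then N / p else 0) + N * ((1 / real p) * (1 / real q))"
    proof (cases "p = q")
      case True
      have "(\<Sum>n=1..N. of_bool (p dvd n) * of_bool (q dvd n) :: real) = (\<Sum>n=1..N. of_bool (p dvd n))"
        by (intro sum.cong) (auto simp: True)
      also have "\<dots> \<le> N / p" unfolding count[OF Qpos[OF p]] by (rule of_nat_div_le_of_nat)
      finally show ?thesis using True by (simp add: add_increasing2)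
    next
      case False
      have "coprime p q" using p q False primes_inD(1) by (intro primes_coprime) auto
      then have "p dvd n \<and> q dvd n \<longleftrightarrow> p * q dvd n" for n by (meson divides_mult dvd_mult_left dvd_mult_right)
      then have "(\<Sum>n=1..N. of_bool (p dvd n) * of_bool (q dvd n) :: real) = (\<Sum>n=1..N. of_bool (p * q dvd n))"
        by (intro sum.cong) (auto simp flip: of_bool_conj)
      also have "\<dots> = real (N div (p * q))" using p q Qpos by (intro count) auto
      also have "\<dots> \<le> N / real (p * q)" by (rule of_nat_div_le_of_nat)
      finally show ?thesis using False by simp
    qed
  qed
  also have "\<dots> = (\<Sum>p\<in>?Q. N / p) + (\<Sum>p\<in>?Q. \<Sum>q\<in>?Q. N * ((1 / p) * (1 / q)))"
    by (simp add: sum.distrib)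
  also have "(\<Sum>p\<in>?Q. N / p) = N * s" by (simp add: s_def sum_distrib_left)
  also have "(\<Sum>p\<in>?Q. \<Sum>q\<in>?Q. N * ((1 / real p) * (1 / real q))) = N * s\<^sup>2"
    by (simp only: s_def power2_eq_square sum_product sum_distrib_left[symmetric])
  finally have second: "(\<Sum>n=1..N. (om n)\<^sup>2) \<le> N * s + N * s\<^sup>2" .
  \<comment> \<open>Chebyshev's inequality: on \<open>prime_free\<close> the deviation of
    \<open>om n\<close> from \<open>s\<close> is exactly \<open>- s\<close>.\<close>
  have "real (card (prime_free N u v)) * s\<^sup>2 = (\<Sum>n\<in>prime_free N u v. (om n - s)\<^sup>2)"
  proof -
    have "om n = 0" if "n \<in> prime_free N u v" for n
      using that by (simp add: om_def prime_free_def del: sum_of_bool_eq)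
    then show ?thesis by simp
  qed
  also have "\<dots> \<le> (\<Sum>n=1..N. (om n - s)\<^sup>2)"
    by (intro sum_mono2) (auto simp: prime_free_def)
  also have "\<dots> = (\<Sum>n=1..N. (om n)\<^sup>2) - 2 * s * (\<Sum>n=1..N. om n) + N * s\<^sup>2"
    by (simp add: power2_diff sum.distrib sum_subtractf sum_distrib_left mult_ac)
  also have "\<dots> \<le> (N * s + N * s\<^sup>2) - 2 * s * (N * s - N) + N * s\<^sup>2"
    using second first s by (intro add_mono diff_mono mult_left_mono) auto
  also have "\<dots> = 3 * N * s" by (simp add: algebra_simps power2_eq_square)
  finally have "real (card (prime_free N u v)) * s \<le> 3 * N"
    using s by (simp add: power2_eq_square flip: mult.assoc)
  then show ?thesis using s by (simp add: field_simps)
qed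

lemma card_prime_free_le_ln_ln:
  assumes "2 \<le> u" "u \<le> v" "v \<le> N" "0 < d" "d \<le> ln (ln v) - ln (ln u) - 11 / ln 2"
  shows "real (card (prime_free N u v)) \<le> 3 * N / d"
proof -
  let ?s = "\<Sum>p\<in>primes_in u v. 1 / real p"
  have "11 / ln u \<le> 11 / ln (2::real)" using assms by (auto intro!: divide_left_mono)
  then have "d \<le> ?s" using abs_sum_inverse_primes_diff_le[of u v] assms by linarith
  then have "3 * N / ?s \<le> 3 * N / d" using assms by (intro divide_left_mono) auto
  with card_prime_free_le[of v N u] assms \<open>d \<le> ?s\<close> show ?thesis by linarith
qed

definition consecutive_prime_factors :: "nat \<Rightarrow> nat \<Rightarrow> nat \<Rightarrow> bool" where
  "consecutive_prime_factors n p q \<longleftrightarrow> prime p \<and> prime q \<and> p dvd n \<and> q dvd n \<and> p < q \<and>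
     (\<forall>r. prime r \<and> r dvd n \<longrightarrow> \<not> (p < r \<and> r < q))"

definition long_gap :: "nat \<Rightarrow> nat \<Rightarrow> bool" where
  "long_gap K n \<longleftrightarrow> (\<exists>p q. consecutive_prime_factors n p q \<and> p ^ K < q)"

text \<open>A long gap that opens above \<open>m\<close> contains one of the boundedly many intervals between consecutive
  points \<open>m ^ (B ^ i)\<close>, where \<open>B\<close> is about the square root of \<open>K\<close>.\<close>

lemma long_gap_above_prime_free:
  assumes n: "n \<in> {1..N}" and m: "2 \<le> m" and B: "2 \<le> B" "B\<^sup>2 \<le> K" "N < m ^ (B ^ 8)"
    and pq: "prime p" "prime q" "p dvd n" "q dvd n" "m < p" "p ^ K < q"
      "\<forall>r. prime r \<and> r dvd n \<longrightarrow> \<not> (p < r \<and> r < q)"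
  shows "\<exists>i<8. m ^ (B ^ Suc i) \<le> N \<and> n \<in> prime_free N (m ^ (B ^ i)) (m ^ (B ^ Suc i))"
proof -
  have "q \<le> N" using n pq dvd_imp_le[of q n] by auto
  define i where "i = (LEAST i. p \<le> m ^ (B ^ i))"
  have "p \<le> m ^ p" using m less_exp[of p] power_mono[of 2 m p] by linarith
  also have "\<dots> \<le> m ^ (B ^ p)"
    using m B less_exp[of p] power_mono[of 2 B p] by (intro power_increasing) linarith+
  finally have i1: "p \<le> m ^ (B ^ i)" unfolding i_def by (rule LeastI)
  have "i \<noteq> 0" using i1 pq by (intro notI) auto
  then obtain j where j: "i = Suc j" by (cases i) auto
  have j1: "m ^ (B ^ j) < p"
    using not_less_Least[of j "\<lambda>i. p \<le> m ^ (B ^ i)"] j by (simp add: i_def)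
  \<comment> \<open>\<open>p\<close> lies between two consecutive points. Since \<open>K\<close> is
    at least the square of \<open>B\<close>, the power \<open>p ^ K\<close> passes two further
    exponents \<open>B\<close>, so the whole next interval lies between \<open>p\<close> and
    \<open>q\<close>.\<close>
  have "m ^ (B ^ Suc i) = (m ^ (B ^ j)) ^ B\<^sup>2"
    by (simp add: j power_mult[symmetric] power2_eq_square mult_ac)
  also have "\<dots> \<le> p ^ B\<^sup>2" using j1 by (intro power_mono) auto
  also have "\<dots> \<le> p ^ K" using pq B m by (intro power_increasing) auto
  finally have up: "m ^ (B ^ Suc i) < q" using pq by simp
  then have N: "m ^ (B ^ Suc i) \<le> N" using \<open>q \<le> N\<close> by simp
  have "\<not> 8 \<le> Suc i"
  proof
    assume "8 \<le> Suc i"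
    then have "m ^ (B ^ 8) \<le> m ^ (B ^ Suc i)" using m B by (intro power_increasing) auto
    with N B show False by simp
  qed
  then have "i < 8" by simp
  moreover have "n \<in> prime_free N (m ^ (B ^ i)) (m ^ (B ^ Suc i))"
    unfolding prime_free_def
  proof (intro CollectI conjI ballI n notI)
    fix r assume "r \<in> primes_in (m ^ (B ^ i)) (m ^ (B ^ Suc i))" "r dvd n"
    with i1 up pq(7) show False by (auto simp: primes_in_def)
  qed
  ultimately show ?thesis using N by blast
qed

text \<open>There are two discrepancies. A long gap above \<open>m\<close> empties one of eight
  intervals, each of \<open>ln ln\<close>-length \<open>ln B\<close>, which gives 24 as 8 times 3. A
  gap up to \<open>m\<close> that no larger prime factor closes leaves \<open>n\<close> without
  prime factors in (m, N].\<close>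

lemma abs_card_long_gap_diff_le:
  fixes N m K B :: nat
  assumes m: "2 \<le> m" "m \<le> N" and B: "2 \<le> B" "B\<^sup>2 \<le> K" "N < m ^ (B ^ 8)"
    and d: "0 < ln B - 11 / ln 2" "0 < ln (ln N) - ln (ln m) - 11 / ln 2"
  defines "G \<equiv> {n\<in>{1..N}. \<exists>p\<le>m. gap_from K p (small_primes_of (m ^ K) n)}"
  shows "\<bar>real (card {n\<in>{1..N}. long_gap K n}) - real (card G)\<bar>
          \<le> 24 * N / (ln B - 11 / ln 2) + 3 * N / (ln (ln N) - ln (ln m) - 11 / ln 2)"
proof -
  let ?L = "{n\<in>{1..N}. long_gap K n}"
  define Z where "Z = (\<lambda>i. if m ^ (B ^ Suc i) \<le> N then prime_free N (m ^ (B ^ i)) (m ^ (B ^ Suc i)) else {})"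
  have K: "K > 0" using B by (cases "K = 0") auto
  have finZ: "finite (Z i)" for i by (simp add: Z_def prime_free_def)
  have "?L \<subseteq> G \<union> (\<Union>i<8. Z i)"
  proof
    fix n assume n: "n \<in> ?L"
    then obtain p q where pq: "prime p" "prime q" "p dvd n" "q dvd n" "p < q" "p ^ K < q"
      "\<forall>r. prime r \<and> r dvd n \<longrightarrow> \<not> (p < r \<and> r < q)" by (auto simp: long_gap_def consecutive_prime_factors_def)
    show "n \<in> G \<union> (\<Union>i<8. Z i)"
    proof (cases "p \<le> m")
      case True
      have "m \<le> m ^ K" using K m by (simp add: self_le_power)
      then have "gap_from K p (small_primes_of (m ^ K) n)"
        using pq True by (auto simp: gap_from_def small_primes_of_def primes_in_def prime_gt_0_nat)
      then show ?thesis using n True by (auto simp: G_def)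
    next
      case False
      then show ?thesis
        using long_gap_above_prime_free[of n N m B K p q] n m B pq by (auto simp: Z_def)
    qed
  qed
  then have "card ?L \<le> card (G \<union> (\<Union>i<8. Z i))"
    using finZ by (intro card_mono) (auto simp: G_def)
  also have "\<dots> \<le> card G + card (\<Union>i<8. Z i)" by (rule card_Un_le)
  also have "card (\<Union>i<8. Z i) \<le> (\<Sum>i<8. card (Z i))" by (rule card_UN_le) simp
  finally have "card ?L \<le> card G + (\<Sum>i<8. card (Z i))" by simp
  then have "real (card ?L) \<le> real (card G + (\<Sum>i<8. card (Z i)))" by (rule of_nat_mono)
  also have "\<dots> = real (card G) + (\<Sum>i<8. real (card (Z i)))"
    by (simp only: of_nat_add of_nat_sum)
  also have "(\<Sum>i<8. real (card (Z i))) \<le> (\<Sum>i<(8::nat). 3 * N / (ln B - 11 / ln 2))"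
  proof (intro sum_mono)
    fix i
    show "real (card (Z i)) \<le> 3 * N / (ln B - 11 / ln 2)"
    proof (cases "m ^ (B ^ Suc i) \<le> N")
      case True
      have le: "m ^ (B ^ i) \<le> m ^ (B ^ Suc i)" using m B by (intro power_increasing) auto
      have "m ^ 1 \<le> m ^ (B ^ i)" using m B by (intro power_increasing) auto
      then have ge2: "2 \<le> m ^ (B ^ i)" using m by simp
      have "m ^ (B ^ Suc i) = (m ^ (B ^ i)) ^ B" by (simp add: power_mult[symmetric] mult.commute)
      then have "ln (ln (real (m ^ (B ^ Suc i)))) = ln B + ln (ln (real (m ^ (B ^ i))))"
        using ln_ln_power[of "m ^ (B ^ i)" B] ge2 B by simp
      then have "ln B - 11 / ln 2 \<le> ln (ln (real (m ^ (B ^ Suc i)))) - ln (ln (real (m ^ (B ^ i)))) - 11 / ln 2"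
        by linarith
      from card_prime_free_le_ln_ln[OF ge2 le True d(1) this] show ?thesis
        using True by (simp add: Z_def)
    qed (use d in \<open>simp add: Z_def\<close>)
  qed
  also have "\<dots> = 24 * N / (ln B - 11 / ln 2)" by simp
  finally have 1: "real (card ?L) \<le> real (card G) + 24 * N / (ln B - 11 / ln 2)" by simp
  have "G \<subseteq> ?L \<union> prime_free N m N"
  proof
    fix n assume n: "n \<in> G"
    then obtain p where p: "p \<le> m" "gap_from K p (small_primes_of (m ^ K) n)" and n1: "n \<in> {1..N}"
      by (auto simp: G_def)
    have pp: "prime p" "p dvd n" using p by (auto simp: gap_from_def small_primes_of_def primes_in_def)
    have "p ^ K \<le> m ^ K" using p by (intro power_mono) auto
    have gap: "p ^ K < r" if r: "prime r" "r dvd n" "p < r" for r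
    proof (rule ccontr)
      assume "\<not> p ^ K < r"
      then have "r \<in> small_primes_of (m ^ K) n \<inter> {p<..p ^ K}"
        using r \<open>p ^ K \<le> m ^ K\<close> prime_gt_0_nat[of r] by (simp add: small_primes_of_def primes_in_def)
      with p(2) show False by (auto simp: gap_from_def)
    qed
    show "n \<in> ?L \<union> prime_free N m N"
    proof (cases "\<exists>r. prime r \<and> r dvd n \<and> p < r")
      case True
      define q where "q = (LEAST r. prime r \<and> r dvd n \<and> p < r)"
      have q: "prime q \<and> q dvd n \<and> p < q" unfolding q_def by (rule LeastI_ex[OF True])
      have "\<not> (p < r \<and> r < q)" if "prime r \<and> r dvd n" for r
        using not_less_Least[of r "\<lambda>r. prime r \<and> r dvd n \<and> p < r"] that by (auto simp: q_def)
      then have "long_gap K n" unfolding long_gap_def consecutive_prime_factors_def using q pp gap[of q] by blast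
      with n1 show ?thesis by simp
    next
      case False
      then have "n \<in> prime_free N m N" using n1 p by (auto simp: prime_free_def primes_in_def)
      then show ?thesis by simp
    qed
  qed
  then have "card G \<le> card (?L \<union> prime_free N m N)" by (intro card_mono) (auto simp: prime_free_def)
  also have "\<dots> \<le> card ?L + card (prime_free N m N)" by (rule card_Un_le)
  finally have "real (card G) \<le> real (card ?L) + real (card (prime_free N m N))" by linarith
  moreover have "real (card (prime_free N m N)) \<le> 3 * N / (ln (ln N) - ln (ln m) - 11 / ln 2)"
    using card_prime_free_le_ln_ln[of m N N] m d by simp
  moreover have "0 \<le> 24 * N / (ln B - 11 / ln 2)" "0 \<le> 3 * N / (ln (ln N) - ln (ln m) - 11 / ln 2)"
    using d by simp_all
  ultimately show ?thesis using 1 by linarith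
qed

section \<open>The density of integers with a long gap\<close>

lemma sum_inverse_primes_le:
  assumes "2 \<le> y"
  shows "(\<Sum>p\<in>primes_in 0 y. 1 / real p) \<le> ln (ln y) + (1 - ln (ln 2) + 11 / ln 2)"
proof -
  have "primes_in 0 y = insert 2 (primes_in 2 y)"
  proof (intro equalityI subsetI)
    fix p assume "p \<in> primes_in 0 y"
    then show "p \<in> insert 2 (primes_in 2 y)"
      using primes_in_ge2[of p 0 y] by (auto simp: primes_in_def)
  qed (use assms in \<open>auto simp: primes_in_def\<close>)
  then have "(\<Sum>p\<in>primes_in 0 y. 1 / real p) = 1 / 2 + (\<Sum>p\<in>primes_in 2 y. 1 / real p)"
    by (simp add: primes_in_def)
  also have "\<dots> \<le> 1 / 2 + (ln (ln y) - ln (ln 2) + 11 / ln 2)"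
    using abs_sum_inverse_primes_diff_le[of 2 y] assms by simp
  finally show ?thesis by simp
qed

text \<open>With \<open>T = ln (ln N)\<close> and \<open>m = gap_cutoff N\<close>, \<open>ln (ln m)\<close> is asymptotic to \<open>T\<close>, so that almost all
  of the sum over \<open>p\<close> is kept, while \<open>m ^ K\<close> with \<open>K\<close> of order \<open>T\<close> is at most \<open>N\<close> to a power of order
  \<open>1 / T\<^sup>2\<close>, small enough for a sieve that is truncated after about \<open>10 * T\<close> steps.\<close>

definition gap_cutoff :: "nat \<Rightarrow> nat" where
  "gap_cutoff N = nat \<lfloor>exp (ln N / ln (ln N) ^ 3)\<rfloor>"

lemma ln_gap_cutoff_le:
  assumes "gap_cutoff N > 0"
  shows "ln (gap_cutoff N) \<le> ln N / ln (ln N) ^ 3"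
proof -
  have "real (gap_cutoff N) \<le> exp (ln N / ln (ln N) ^ 3)"
    unfolding gap_cutoff_def by (simp add: of_nat_nat)
  then have "ln (gap_cutoff N) \<le> ln (exp (ln N / ln (ln N) ^ 3))" using assms by (intro ln_mono) auto
  then show ?thesis by simp
qed

text \<open>The hypothesis \<open>small\<close> implies \<open>m ^ K <= N\<close> and hence
  \<open>\<sigma> <= T + C\<close>. Taking \<open>r\<close> at least \<open>10 * T\<close> against
  \<open>9 * \<sigma>\<close> makes the first term of order \<open>exp (- T)\<close>; the second is
  of order \<open>exp (2 * T) / sqrt N\<close>.\<close>

lemma sieve_error_le:
  fixes N m K r :: nat and C T :: real
  defines "C \<equiv> 1 - ln (ln 2) + 11 / ln 2" and "T \<equiv> ln (ln N)"
  assumes m: "2 \<le> m" and K: "K > 0" and N: "N > 0" and r: "r > 0" "10 * T \<le> r"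
    and small: "2 * r * K * ln m \<le> ln N / 2"
  defines "\<sigma> \<equiv> (\<Sum>p\<in>primes_in 0 (m ^ K). 1 / real p)"
  shows "2 * exp (9 * \<sigma>) / 8 ^ r + real (m ^ K) ^ (2 * r) * exp (2 * \<sigma>) / N
          \<le> 2 * exp (9 * (T + C)) / exp (10 * T) + exp (ln N / 2) * exp (2 * (T + C)) / N"
proof -
  have y2: "2 \<le> m ^ K" using m K self_le_power[of m K] by linarith
  have "real K * ln m * 1 \<le> real K * ln m * (2 * r)" using r m by (intro mult_left_mono) auto
  also have "\<dots> \<le> ln N / 2" using small by (simp add: mult_ac)
  also have "\<dots> \<le> ln N" using N by simp
  finally have "ln (real (m ^ K)) \<le> ln N" using m by (simp add: ln_realpow)
  moreover have "ln (real (m ^ K)) > 0" using y2 by (intro ln_gt_zero) (simp del: of_nat_power)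
  ultimately have "ln (ln (real (m ^ K))) \<le> T" unfolding T_def by (intro ln_mono[of "ln (real (m ^ K))"])
  then have \<sigma>: "\<sigma> \<le> T + C"
    using sum_inverse_primes_le[OF y2] unfolding \<sigma>_def C_def by linarith
  have "exp (10 * T) \<le> exp (real r)" using r by simp
  also have "\<dots> = exp 1 ^ r" by (simp flip: exp_of_nat_mult)
  also have "\<dots> \<le> 8 ^ r" using exp_le by (intro power_mono) auto
  finally have e8: "exp (10 * T) \<le> 8 ^ r" .
  have 1: "2 * exp (9 * \<sigma>) / 8 ^ r \<le> 2 * exp (9 * (T + C)) / exp (10 * T)"
    using \<sigma> e8 by (intro frac_le) auto
  have "real (m ^ K) ^ (2 * r) = exp (2 * r * K * ln m)"
  proof -
    have "exp (2 * r * K * ln m) = exp (real (K * (2 * r)) * ln m)" by (simp add: mult_ac)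
    also have "\<dots> = exp (ln m) ^ (K * (2 * r))" by (rule exp_of_nat_mult)
    finally show ?thesis using m by (simp add: power_mult)
  qed
  also have "\<dots> \<le> exp (ln N / 2)" using small by simp
  finally have "real (m ^ K) ^ (2 * r) * exp (2 * \<sigma>) / N \<le> exp (ln N / 2) * exp (2 * (T + C)) / N"
    using \<sigma> by (intro divide_right_mono mult_mono) auto
  with 1 show ?thesis by linarith
qed

lemma long_gap_density:
  fixes K :: "nat \<Rightarrow> nat" and c :: real
  assumes c: "c > 0" and lim: "(\<lambda>N. K N / ln (ln N)) \<longlonglongrightarrow> c"
  shows "(\<lambda>N. card {n\<in>{1..N}. long_gap (K N) n} / N) \<longlonglongrightarrow> 1 - exp (- (1 / c))"
proof -
  define T where "T = (\<lambda>N::nat. ln (ln (real N)))"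
  define m where "m = gap_cutoff"
  define B where "B = (\<lambda>N. nat \<lfloor>sqrt (K N)\<rfloor>)"
  \<comment> \<open>Odd, as the lower Bonferroni inequality requires, and between
    \<open>10 * T\<close> and \<open>10 * T + 5\<close>.\<close>
  define r where "r = (\<lambda>N. 2 * nat \<lceil>5 * T N\<rceil> + 1)"
  define C where "C = 1 - ln (ln 2) + 11 / ln (2::real)"
  have T_top: "filterlim T at_top sequentially" unfolding T_def by real_asymp
  have T_pos: "eventually (\<lambda>N. T N > 0) sequentially" unfolding T_def by real_asymp
  have "eventually (\<lambda>N. K N / ln (ln N) > c / 2) sequentially"
    by (rule order_tendstoD[OF lim]) (use c in auto)
  with T_pos have K_ge: "eventually (\<lambda>N. c / 2 * T N \<le> K N) sequentially"
    by eventually_elim (simp add: T_def field_simps)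
  have "eventually (\<lambda>N. K N / ln (ln N) < 2 * c) sequentially"
    by (rule order_tendstoD[OF lim]) (use c in auto)
  with T_pos have K_le: "eventually (\<lambda>N. K N \<le> 2 * c * T N) sequentially"
    by eventually_elim (simp add: T_def field_simps)
  have "filterlim (\<lambda>N. c / 2 * T N) at_top sequentially"
    by (rule filterlim_tendsto_pos_mult_at_top[OF tendsto_const _ T_top]) (use c in auto)
  then have "filterlim (\<lambda>N. real (K N)) at_top sequentially"
    using K_ge by (rule filterlim_at_top_mono)
  then have "eventually (\<lambda>N. real Z \<le> real (K N)) sequentially" for Z
    unfolding filterlim_at_top by blast
  then have K_top: "filterlim K at_top sequentially" unfolding filterlim_at_top by simp
  have m_top: "filterlim m at_top sequentially" unfolding m_def gap_cutoff_def by real_asymp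
  have m_lim: "(\<lambda>N. ln (ln (m N)) / T N) \<longlonglongrightarrow> 1"
    unfolding m_def gap_cutoff_def T_def by real_asymp
  have m_gap: "filterlim (\<lambda>N. T N - ln (ln (m N)) - 11 / ln 2) at_top sequentially"
    unfolding m_def gap_cutoff_def T_def by real_asymp
  have m_le: "eventually (\<lambda>N. m N \<le> N) sequentially"
    unfolding m_def gap_cutoff_def by real_asymp
  \<comment> \<open>This makes eight intervals enough: \<open>ln N / ln m\<close> is about
    \<open>T ^ 3\<close>, while \<open>B ^ 2 >= K / 4\<close> makes \<open>B ^ 8\<close> of order at
    least \<open>T ^ 4\<close>.\<close>
  have m_pow: "eventually (\<lambda>N. (c * T N / 8) ^ 4 * ln (m N) > ln N) sequentially"
    unfolding m_def gap_cutoff_def T_def using c by real_asymp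
  \<comment> \<open>The sieve needs \<open>m ^ K\<close> to the power \<open>2 * r\<close> below
    \<open>sqrt N\<close>. Both \<open>r\<close> and \<open>K\<close> are of order \<open>T\<close>,
    so the cube in \<open>gap_cutoff\<close> leaves a factor \<open>1 / T\<close> to spare.\<close>
  have sieve: "eventually (\<lambda>N::nat. 2 * (10 * T N + 5) * (2 * c * T N) * (ln N / T N ^ 3) \<le> ln N / 2) sequentially"
    unfolding T_def using c by real_asymp
  have B_top: "filterlim (\<lambda>N. ln (B N) - 11 / ln 2) at_top sequentially"
  proof -
    have "filterlim (\<lambda>k. ln (real (nat \<lfloor>sqrt (real k)\<rfloor>)) - 11 / ln 2) at_top sequentially" by real_asymp
    from filterlim_compose[OF this K_top] show ?thesis by (simp add: B_def)
  qed
  have m2: "eventually (\<lambda>N. 2 \<le> m N) sequentially"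
    using m_top[unfolded filterlim_at_top, rule_format, of 2] .
  have K4: "eventually (\<lambda>N. 4 \<le> K N) sequentially"
    using K_top[unfolded filterlim_at_top, rule_format, of 4] .
  have B_pos: "eventually (\<lambda>N. 0 < ln (B N) - 11 / ln 2) sequentially"
    using B_top[unfolded filterlim_at_top_dense, rule_format, of 0] .
  have gap_pos: "eventually (\<lambda>N. 0 < T N - ln (ln (m N)) - 11 / ln 2) sequentially"
    using m_gap[unfolded filterlim_at_top_dense, rule_format, of 0] .
  define G where "G = (\<lambda>N. {n\<in>{1..N}. \<exists>p\<le>m N. gap_from (K N) p (small_primes_of (m N ^ K N) n)})"
  have "(\<lambda>N. T N / K N) \<longlonglongrightarrow> 1 / c"
    using tendsto_inverse[OF lim] c by (simp add: T_def inverse_eq_divide)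
  then have "(\<lambda>N. ln (ln (m N)) / T N * (T N / K N)) \<longlonglongrightarrow> 1 * (1 / c)"
    by (intro tendsto_mult m_lim)
  moreover have "eventually (\<lambda>N. ln (ln (m N)) / T N * (T N / K N) = ln (ln (m N)) / K N) sequentially"
    using T_pos by eventually_elim simp
  ultimately have "(\<lambda>N. ln (ln (m N)) / K N) \<longlonglongrightarrow> 1 * (1 / c)"
    by (rule Lim_transform_eventually)
  then have L: "(\<lambda>N. ln (ln (m N)) / K N) \<longlonglongrightarrow> 1 / c" by simp
  have "(\<lambda>N. 1 - no_gap_prob (m N ^ K N) (K N) (m N)) \<longlonglongrightarrow> 1 - exp (- (1 / c))"
    by (intro tendsto_diff tendsto_const no_gap_prob_tendsto[OF K_top m_top L]) simp
  moreover have "1 - no_gap_prob y k M = prime_model y (\<lambda>S. \<exists>p\<le>M. gap_from k p S)" for y k M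
  proof -
    have "prime_model y (\<lambda>S. (\<exists>p\<le>M. gap_from k p S) \<or> (\<forall>p\<le>M. \<not> gap_from k p S))
        = prime_model y (\<lambda>S. \<exists>p\<le>M. gap_from k p S) + no_gap_prob y k M"
      unfolding no_gap_prob_def by (rule bern_prob_disj_eq) auto
    moreover have "prime_model y (\<lambda>S. (\<exists>p\<le>M. gap_from k p S) \<or> (\<forall>p\<le>M. \<not> gap_from k p S))
        = prime_model y (\<lambda>_. True)" by (rule bern_prob_cong) auto
    ultimately show ?thesis by (simp add: bern_prob_True)
  qed
  ultimately have model: "(\<lambda>N. prime_model (m N ^ K N) (\<lambda>S. \<exists>p\<le>m N. gap_from (K N) p S)) \<longlonglongrightarrow> 1 - exp (- (1 / c))"
    by simp
  have G: "(\<lambda>N. card (G N) / N) \<longlonglongrightarrow> 1 - exp (- (1 / c))"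
  proof (rule tendsto_of_abs_diff_le[OF _ _ model])
    show "(\<lambda>N. 2 * exp (9 * (T N + C)) / exp (10 * T N) + exp (ln N / 2) * exp (2 * (T N + C)) / N) \<longlonglongrightarrow> 0"
      unfolding T_def by real_asymp
    show "eventually (\<lambda>N. \<bar>card (G N) / N - prime_model (m N ^ K N) (\<lambda>S. \<exists>p\<le>m N. gap_from (K N) p S)\<bar>
        \<le> 2 * exp (9 * (T N + C)) / exp (10 * T N) + exp (ln N / 2) * exp (2 * (T N + C)) / N) sequentially"
      using m2 K4 K_le T_pos sieve eventually_gt_at_top[of 0]
    proof eventually_elim
      case (elim N)
      have r1: "10 * T N \<le> r N" "r N \<le> 10 * T N + 5" using elim(4) unfolding r_def by linarith+
      have lnm: "ln (m N) \<le> ln N / T N ^ 3" "0 \<le> ln (m N)"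
        using ln_gap_cutoff_le[of N] elim by (auto simp: m_def T_def)
      have "2 * real (r N) * real (K N) * ln (m N) \<le> 2 * (10 * T N + 5) * (2 * c * T N) * (ln N / T N ^ 3)"
        using r1 elim lnm c by (intro mult_mono) auto
      also have "\<dots> \<le> ln N / 2" using elim by simp
      finally have small: "2 * real (r N) * real (K N) * ln (m N) \<le> ln N / 2" .
      have "\<bar>prime_model (m N ^ K N) (\<lambda>S. \<exists>p\<le>m N. gap_from (K N) p S) - card (G N) / N\<bar>
          \<le> 2 * exp (9 * (\<Sum>p\<in>primes_in 0 (m N ^ K N). 1 / real p)) / 8 ^ r N
             + real (m N ^ K N) ^ (2 * r N) * exp (2 * (\<Sum>p\<in>primes_in 0 (m N ^ K N). 1 / real p)) / N"
        unfolding G_def by (rule abs_prime_model_minus_density_le) (use elim in \<open>auto simp: r_def\<close>)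
      also have "\<dots> \<le> 2 * exp (9 * (T N + C)) / exp (10 * T N) + exp (ln N / 2) * exp (2 * (T N + C)) / N"
        unfolding T_def C_def by (rule sieve_error_le) (use elim r1 small in \<open>auto simp: T_def\<close>)
      finally show ?case by (simp add: abs_minus_commute)
    qed
  qed
  show ?thesis
  proof (rule tendsto_of_abs_diff_le[OF _ _ G])
    have "(\<lambda>N. 24 / (ln (B N) - 11 / ln 2) + 3 / (T N - ln (ln (m N)) - 11 / ln 2)) \<longlonglongrightarrow> 0 + 0"
      by (intro tendsto_add real_tendsto_divide_at_top[OF tendsto_const] B_top m_gap)
    then show "(\<lambda>N. 24 / (ln (B N) - 11 / ln 2) + 3 / (T N - ln (ln (m N)) - 11 / ln 2)) \<longlonglongrightarrow> 0"
      by simp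
    show "eventually (\<lambda>N. \<bar>card {n\<in>{1..N}. long_gap (K N) n} / N - card (G N) / N\<bar>
        \<le> 24 / (ln (B N) - 11 / ln 2) + 3 / (T N - ln (ln (m N)) - 11 / ln 2)) sequentially"
      using m2 m_le K4 K_ge T_pos B_pos gap_pos m_pow eventually_gt_at_top[of 0]
    proof eventually_elim
      case (elim N)
      have B1: "real (B N) \<le> sqrt (K N)" "sqrt (K N) < real (B N) + 1"
        unfolding B_def by (auto simp: of_nat_nat)
      have "sqrt (real 4) \<le> sqrt (K N)" using elim by (intro real_sqrt_le_mono) simp
      then have B2: "2 \<le> B N" unfolding B_def by (simp add: le_nat_iff le_floor_iff)
      have "real (B N) ^ 2 \<le> sqrt (K N) ^ 2" using B1 by (intro power_mono) auto
      then have BK: "(B N)\<^sup>2 \<le> K N" by (simp flip: of_nat_power)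
      have "sqrt (K N) ^ 2 \<le> (2 * real (B N)) ^ 2" using B1 B2 by (intro power_mono) auto
      then have "real (K N) / 4 \<le> real (B N) ^ 2" by (simp add: power_mult_distrib)
      then have "(c * T N / 8) \<le> real (B N) ^ 2" using elim by simp
      then have "(c * T N / 8) ^ 4 \<le> (real (B N) ^ 2) ^ 4" using elim c by (intro power_mono) auto
      then have "(c * T N / 8) ^ 4 * ln (m N) \<le> real (B N) ^ 8 * ln (m N)"
        using elim by (intro mult_right_mono) (auto simp flip: power_mult)
      then have "ln N < real (B N ^ 8) * ln (m N)" using elim(8) unfolding of_nat_power by linarith
      also have "\<dots> = ln (real (m N ^ (B N ^ 8)))" using elim by (simp add: ln_realpow)
      finally have "real N < real (m N ^ (B N ^ 8))" using elim by (subst (asm) ln_less_cancel_iff) auto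
      then have Nm: "N < m N ^ (B N ^ 8)" by (simp only: of_nat_less_iff)
      have "\<bar>real (card {n\<in>{1..N}. long_gap (K N) n}) - real (card (G N))\<bar>
          \<le> 24 * N / (ln (B N) - 11 / ln 2) + 3 * N / (ln (ln N) - ln (ln (m N)) - 11 / ln 2)"
        unfolding G_def by (rule abs_card_long_gap_diff_le) (use elim B2 BK Nm in \<open>auto simp: T_def\<close>)
      then have "\<bar>real (card {n\<in>{1..N}. long_gap (K N) n}) - real (card (G N))\<bar> / N
          \<le> (24 * N / (ln (B N) - 11 / ln 2) + 3 * N / (ln (ln N) - ln (ln (m N)) - 11 / ln 2)) / N"
        by (intro divide_right_mono) auto
      then show ?case using elim by (simp add: T_def add_divide_distrib flip: diff_divide_distrib)
    qed
  qed
qed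

section \<open>Asymptotic densities\<close>

lemma consecutive_nth_iff:
  fixes A :: "nat set"
  assumes "finite A"
  defines "xs \<equiv> sorted_list_of_set A"
  shows "(p \<in> A \<and> q \<in> A \<and> p < q \<and> (\<forall>r\<in>A. \<not> (p < r \<and> r < q))) \<longleftrightarrow>
    (\<exists>i. Suc i < card A \<and> p = xs ! i \<and> q = xs ! Suc i)"
proof -
  have set: "set xs = A" and len: "length xs = card A" using assms by (auto simp: xs_def)
  have "sorted_wrt (<) xs" by (simp add: xs_def)
  then have mono: "xs ! i < xs ! j" if "i < j" "j < card A" for i j
    using that len by (auto intro: sorted_wrt_nth_less)
  then have mono_iff: "xs ! i < xs ! j \<longleftrightarrow> i < j" if "i < card A" "j < card A" for i j
    using that by (metis linorder_neqE_nat order.asym order.irrefl)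
  have mem: "r \<in> A \<longleftrightarrow> (\<exists>i<card A. r = xs ! i)" for r
    unfolding set[symmetric] in_set_conv_nth len by auto
  show ?thesis
  proof
    assume L: "p \<in> A \<and> q \<in> A \<and> p < q \<and> (\<forall>r\<in>A. \<not> (p < r \<and> r < q))"
    then obtain i j where ij: "i < card A" "p = xs ! i" "j < card A" "q = xs ! j" using mem by auto
    have "i < j" using L ij mono_iff by auto
    have "\<not> Suc i < j"
    proof
      assume "Suc i < j"
      then have "Suc i < card A" "p < xs ! Suc i" "xs ! Suc i < q" using ij mono_iff by auto
      with L mem show False by blast
    qed
    with \<open>i < j\<close> have "j = Suc i" by simp
    with ij show "\<exists>i. Suc i < card A \<and> p = xs ! i \<and> q = xs ! Suc i" by blast
  next
    assume "\<exists>i. Suc i < card A \<and> p = xs ! i \<and> q = xs ! Suc i"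
    then obtain i where i: "Suc i < card A" "p = xs ! i" "q = xs ! Suc i" by blast
    have "\<not> (p < r \<and> r < q)" if r: "r \<in> A" for r
    proof -
      obtain k where "k < card A" "r = xs ! k" using r mem[of r] by auto
      then show ?thesis using i mono_iff[of i k] mono_iff[of k "Suc i"] by auto
    qed
    moreover have "p \<in> A" "q \<in> A" using i mem Suc_lessD by blast+
    moreover have "p < q" using i mono by auto
    ultimately show "p \<in> A \<and> q \<in> A \<and> p < q \<and> (\<forall>r\<in>A. \<not> (p < r \<and> r < q))" by blast
  qed
qed

lemma consecutive_prime_factors_iff_nth:
  assumes "n > 0"
  shows "consecutive_prime_factors n p q \<longleftrightarrow>
    (\<exists>j\<in>{1..<omega n}. p = nth_prime_factor n j \<and> q = nth_prime_factor n (j + 1))"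
proof -
  have mem: "r \<in> prime_factors n \<longleftrightarrow> prime r \<and> r dvd n" for r
    using assms by (auto simp: in_prime_factors_iff)
  have "consecutive_prime_factors n p q \<longleftrightarrow>
      (p \<in> prime_factors n \<and> q \<in> prime_factors n \<and> p < q \<and> (\<forall>r\<in>prime_factors n. \<not> (p < r \<and> r < q)))"
    unfolding consecutive_prime_factors_def mem Ball_def by blast
  also have "\<dots> \<longleftrightarrow> (\<exists>i. Suc i < omega n \<and> p = sorted_list_of_set (prime_factors n) ! i
        \<and> q = sorted_list_of_set (prime_factors n) ! Suc i)"
    unfolding omega_def by (rule consecutive_nth_iff) simp
  also have "\<dots> \<longleftrightarrow> (\<exists>j\<in>{1..<omega n}. p = nth_prime_factor n j \<and> q = nth_prime_factor n (j + 1))"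
  proof
    assume "\<exists>i. Suc i < omega n \<and> p = sorted_list_of_set (prime_factors n) ! i
        \<and> q = sorted_list_of_set (prime_factors n) ! Suc i"
    then obtain i where "Suc i < omega n" "p = sorted_list_of_set (prime_factors n) ! i"
        "q = sorted_list_of_set (prime_factors n) ! Suc i" by blast
    then show "\<exists>j\<in>{1..<omega n}. p = nth_prime_factor n j \<and> q = nth_prime_factor n (j + 1)"
      by (intro bexI[of _ "Suc i"]) (auto simp: nth_prime_factor_def)
  next
    assume "\<exists>j\<in>{1..<omega n}. p = nth_prime_factor n j \<and> q = nth_prime_factor n (j + 1)"
    then obtain j where "j \<in> {1..<omega n}" "p = nth_prime_factor n j" "q = nth_prime_factor n (j + 1)" by blast
    then show "\<exists>i. Suc i < omega n \<and> p = sorted_list_of_set (prime_factors n) ! i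
        \<and> q = sorted_list_of_set (prime_factors n) ! Suc i"
      by (intro exI[of _ "j - 1"]) (auto simp: nth_prime_factor_def)
  qed
  finally show ?thesis .
qed

text \<open>With fewer than two prime factors the right side is false; \<open>x >= 0\<close> makes
  the default value 0 of \<open>max_log_gap\<close> agree with this.\<close>

lemma less_max_log_gap_iff:
  assumes "n > 0" "x \<ge> 0"
  shows "x < max_log_gap n \<longleftrightarrow> (\<exists>p q. consecutive_prime_factors n p q \<and> x < ln (ln q / ln p))"
proof (cases "omega n \<ge> 2")
  case True
  then have "x < max_log_gap n \<longleftrightarrow>
      (\<exists>j\<in>{1..<omega n}. x < ln (ln (nth_prime_factor n (j + 1)) / ln (nth_prime_factor n j)))"
    unfolding max_log_gap_def by (auto simp: Max_gr_iff)
  then show ?thesis unfolding consecutive_prime_factors_iff_nth[OF assms(1)] by blast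
next
  case False
  then have "{1..<omega n} = {}" by auto
  with False assms(2) show ?thesis
    unfolding consecutive_prime_factors_iff_nth[OF assms(1)] by (simp add: max_log_gap_def)
qed

lemma power_less_iff_ln_ratio:
  fixes p q :: nat
  assumes "prime p" "prime q"
  shows "p ^ K < q \<longleftrightarrow> real K < ln q / ln p"
proof -
  have "p > 1" "q > 1" using assms prime_gt_1_nat[of p] prime_gt_1_nat[of q] by auto
  then have "p ^ K < q \<longleftrightarrow> ln (real (p ^ K)) < ln q"
    by (subst ln_less_cancel_iff) (auto simp del: of_nat_power)
  also have "\<dots> \<longleftrightarrow> real K < ln q / ln p" using \<open>p > 1\<close> by (simp add: ln_realpow field_simps)
  finally show ?thesis .
qed

lemma iter_ln_3: "iter_ln 3 x = ln (ln (ln x))"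
  by (simp add: iter_ln_def numeral_3_eq_3)

text \<open>The threshold equals \<open>ln (c * ln (ln n))\<close>, so one logarithm cancels. The
  hypothesis \<open>1 <= c * ln (ln n)\<close> makes it nonnegative, as the default value of
  \<open>max_log_gap\<close> demands.\<close>

lemma exceeds_iff_ln_ratio:
  assumes "n > 0" "c > 0" "1 \<le> c * ln (ln n)"
  shows "max_log_gap n > iter_ln 3 n - ln (1 / c) \<longleftrightarrow>
    (\<exists>p q. consecutive_prime_factors n p q \<and> c * ln (ln n) < ln q / ln p)"
proof -
  have "ln (ln (real n)) > 0" 
    using assms zero_less_mult_pos[of c "ln (ln (real n))"] by linarith
  then have eq: "iter_ln 3 n - ln (1 / c) = ln (c * ln (ln n))"
    using assms by (simp add: iter_ln_3 ln_mult ln_div)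
  have "ln (c * ln (ln n)) < ln (ln q / ln p) \<longleftrightarrow> c * ln (ln n) < ln q / ln p"
    if "consecutive_prime_factors n p q" for p q
  proof -
    have "p > 1" "q > 1" using that prime_gt_1_nat by (auto simp: consecutive_prime_factors_def)
    then have "ln q / ln p > 0" by simp
    then show ?thesis using assms by (subst ln_less_cancel_iff) auto
  qed
  then show ?thesis unfolding eq using assms by (subst less_max_log_gap_iff) auto
qed

lemma long_gap_imp_exceeds:
  assumes "n > 0" "c > 0" "1 \<le> c * ln (ln n)" "c * ln (ln n) \<le> K" "long_gap K n"
  shows "max_log_gap n > iter_ln 3 n - ln (1 / c)"
proof -
  obtain p q where pq: "consecutive_prime_factors n p q" "p ^ K < q"
    using assms(5) by (auto simp: long_gap_def)
  then have "real K < ln q / ln p"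
    using power_less_iff_ln_ratio by (auto simp: consecutive_prime_factors_def)
  then have "c * ln (ln n) < ln q / ln p" using assms(4) by linarith
  then show ?thesis using exceeds_iff_ln_ratio[OF assms(1-3)] pq(1) by blast
qed

lemma exceeds_imp_long_gap:
  assumes "n > 0" "c > 0" "1 \<le> c * ln (ln n)" "K \<le> c * ln (ln n)"
    "max_log_gap n > iter_ln 3 n - ln (1 / c)"
  shows "long_gap K n"
proof -
  obtain p q where pq: "consecutive_prime_factors n p q" "c * ln (ln n) < ln q / ln p"
    using assms exceeds_iff_ln_ratio by blast
  then have "p ^ K < q"
    using power_less_iff_ln_ratio[of p q K] assms by (auto simp: consecutive_prime_factors_def)
  with pq show ?thesis by (auto simp: long_gap_def)
qed

lemma ln_ln_of_sqrt_le:
  assumes "sqrt N \<le> n" "n \<le> N" "N > (1::real)"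
  shows "ln (ln N) - ln 2 \<le> ln (ln n)" "ln (ln n) \<le> ln (ln N)"
proof -
  have "1 < sqrt N" using assms by simp
  then have "n > 1" using assms by linarith
  have "ln (ln N / 2) \<le> ln (ln n)"
  proof (rule ln_mono)
    have "ln N / 2 = ln (sqrt N)" using assms by (simp add: ln_sqrt)
    also have "\<dots> \<le> ln n" using assms \<open>1 < sqrt N\<close> by (intro ln_mono) auto
    finally show "ln N / 2 \<le> ln n" .
  qed (use assms in auto)
  then show "ln (ln N) - ln 2 \<le> ln (ln n)" using assms by (simp add: ln_div)
  show "ln (ln n) \<le> ln (ln N)" using assms \<open>n > 1\<close> by simp
qed

lemma card_le_add_sqrt:
  fixes N :: nat
  assumes "\<And>n. n \<in> {1..N} \<Longrightarrow> sqrt N \<le> n \<Longrightarrow> P n \<Longrightarrow> Q n"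
  shows "real (card {n\<in>{1..N}. P n}) / N \<le> real (card {n\<in>{1..N}. Q n}) / N + sqrt N / N"
proof -
  have "{n\<in>{1..N}. P n} \<subseteq> {n\<in>{1..N}. Q n} \<union> {1..nat \<lfloor>sqrt N\<rfloor>}"
  proof
    fix n assume n: "n \<in> {n\<in>{1..N}. P n}"
    show "n \<in> {n\<in>{1..N}. Q n} \<union> {1..nat \<lfloor>sqrt N\<rfloor>}"
    proof (cases "sqrt N \<le> n")
      case False
      then have "n \<le> nat \<lfloor>sqrt N\<rfloor>" by (simp add: le_nat_floor)
      with n show ?thesis by simp
    qed (use n assms in auto)
  qed
  then have "card {n\<in>{1..N}. P n} \<le> card ({n\<in>{1..N}. Q n} \<union> {1..nat \<lfloor>sqrt N\<rfloor>})"
    by (intro card_mono) auto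
  also have "\<dots> \<le> card {n\<in>{1..N}. Q n} + card {1..nat \<lfloor>sqrt N\<rfloor>}" by (rule card_Un_le)
  finally have "real (card {n\<in>{1..N}. P n}) \<le> real (card {n\<in>{1..N}. Q n}) + real (nat \<lfloor>sqrt N\<rfloor>)"
    unfolding card_atLeastAtMost by linarith
  also have "real (nat \<lfloor>sqrt N\<rfloor>) \<le> sqrt N" by (simp add: of_nat_nat)
  finally have "real (card {n\<in>{1..N}. P n}) / N \<le> (real (card {n\<in>{1..N}. Q n}) + sqrt N) / N"
    by (intro divide_right_mono) auto
  then show ?thesis by (simp add: add_divide_distrib)
qed

section \<open>The densities of the theorem\<close>

lemma exceeds_density_nat:
  fixes c :: real
  assumes c: "c > 0"
  shows "(\<lambda>N. card {n\<in>{1..N}. max_log_gap n > iter_ln 3 n - ln (1 / c)} / N) \<longlonglongrightarrow> 1 - exp (- (1 / c))"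
proof -
  let ?A = "\<lambda>n. max_log_gap n > iter_ln 3 n - ln (1 / c)"
  \<comment> \<open>\<open>K1\<close> and \<open>K2\<close> round, outwards, the bounds for
    \<open>c * ln (ln n)\<close> on \<open>sqrt N <= n <= N\<close>. They differ by a bounded
    amount, so both are asymptotic to \<open>c * ln (ln N)\<close> and give the same limit.\<close>
  define K1 where "K1 = (\<lambda>N::nat. nat \<lfloor>c * (ln (ln N) - ln 2)\<rfloor>)"
  define K2 where "K2 = (\<lambda>N::nat. nat \<lceil>c * ln (ln N)\<rceil>)"
  have K1: "(\<lambda>N. K1 N / ln (ln N)) \<longlonglongrightarrow> c" unfolding K1_def using c by real_asymp
  have K2: "(\<lambda>N. K2 N / ln (ln N)) \<longlonglongrightarrow> c" unfolding K2_def using c by real_asymp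
  have sq: "(\<lambda>N::nat. sqrt N / N) \<longlonglongrightarrow> 0" by real_asymp
  have big: "eventually (\<lambda>N::nat. 1 \<le> c * (ln (ln N) - ln 2)) sequentially" using c by real_asymp
  have upper: "eventually (\<lambda>N. card {n\<in>{1..N}. ?A n} / N \<le> card {n\<in>{1..N}. long_gap (K1 N) n} / N + sqrt N / N) sequentially"
    using big eventually_gt_at_top[of 1]
  proof eventually_elim
    case (elim N)
    show ?case
    proof (rule card_le_add_sqrt)
      fix n assume n: "n \<in> {1..N}" "sqrt N \<le> n" "?A n"
      have "ln (ln N) - ln 2 \<le> ln (ln n)" using ln_ln_of_sqrt_le(1)[of N n] n elim by simp
      then have "c * (ln (ln N) - ln 2) \<le> c * ln (ln n)" using c by simp
      moreover have "real (K1 N) \<le> c * (ln (ln N) - ln 2)" unfolding K1_def using elim by linarith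
      ultimately have "1 \<le> c * ln (ln n)" "K1 N \<le> c * ln (ln n)" using elim by linarith+
      then show "long_gap (K1 N) n" using n c by (intro exceeds_imp_long_gap[of n c]) auto
    qed
  qed
  have lower: "eventually (\<lambda>N. card {n\<in>{1..N}. long_gap (K2 N) n} / N - sqrt N / N \<le> card {n\<in>{1..N}. ?A n} / N) sequentially"
    using big eventually_gt_at_top[of 1]
  proof eventually_elim
    case (elim N)
    have "card {n\<in>{1..N}. long_gap (K2 N) n} / N \<le> card {n\<in>{1..N}. ?A n} / N + sqrt N / N"
    proof (rule card_le_add_sqrt)
      fix n assume n: "n \<in> {1..N}" "sqrt N \<le> n" "long_gap (K2 N) n"
      have "ln (ln N) - ln 2 \<le> ln (ln n)" "ln (ln n) \<le> ln (ln N)"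
        using ln_ln_of_sqrt_le[of N n] n elim by simp_all
      then have "c * (ln (ln N) - ln 2) \<le> c * ln (ln n)" "c * ln (ln n) \<le> c * ln (ln N)" using c by simp_all
      moreover have "c * ln (ln N) \<le> K2 N" unfolding K2_def by linarith
      ultimately have "1 \<le> c * ln (ln n)" "c * ln (ln n) \<le> K2 N" using elim by linarith+
      then show "?A n" using n c by (intro long_gap_imp_exceeds[of n c "K2 N"]) auto
    qed
    then show ?case by simp
  qed
  have U: "(\<lambda>N. card {n\<in>{1..N}. long_gap (K1 N) n} / N + sqrt N / N) \<longlonglongrightarrow> 1 - exp (- (1 / c)) + 0"
    by (intro tendsto_add long_gap_density[OF c K1] sq)
  have L: "(\<lambda>N. card {n\<in>{1..N}. long_gap (K2 N) n} / N - sqrt N / N) \<longlonglongrightarrow> 1 - exp (- (1 / c)) - 0"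
    by (intro tendsto_diff long_gap_density[OF c K2] sq)
  show ?thesis
    by (rule tendsto_sandwich[OF lower upper L[unfolded diff_0_right] U[unfolded add_0_right]])
qed

lemma has_asymptotic_densityI:
  assumes "(\<lambda>N. card {n\<in>{1..N}. n \<in> A} / N) \<longlonglongrightarrow> \<delta>"
  shows "has_asymptotic_density A \<delta>"
proof -
  have fl: "filterlim (\<lambda>x::real. nat \<lfloor>x\<rfloor>) sequentially at_top" by real_asymp
  have "((\<lambda>x::real. real (nat \<lfloor>x\<rfloor>) / x) \<longlongrightarrow> 1) at_top" by real_asymp
  from tendsto_mult[OF filterlim_compose[OF assms fl] this]
  have "((\<lambda>x::real. card {n\<in>{1..nat \<lfloor>x\<rfloor>}. n \<in> A} / nat \<lfloor>x\<rfloor> * (nat \<lfloor>x\<rfloor> / x)) \<longlongrightarrow> \<delta>) at_top"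
    by simp
  moreover have "eventually (\<lambda>x::real. card {n\<in>{1..nat \<lfloor>x\<rfloor>}. n \<in> A} / nat \<lfloor>x\<rfloor> * (nat \<lfloor>x\<rfloor> / x)
      = card {n\<in>A. 1 \<le> n \<and> real n \<le> x} / x) at_top"
    using eventually_ge_at_top[of 1]
  proof eventually_elim
    case (elim x)
    have eq: "{n\<in>{1..nat \<lfloor>x\<rfloor>}. n \<in> A} = {n\<in>A. 1 \<le> n \<and> real n \<le> x}"
      using elim by (auto simp: le_nat_floor le_nat_iff le_floor_iff)
    have pos: "real (nat \<lfloor>x\<rfloor>) > 0" using elim by (simp add: zero_less_floor)
    have "a / b * (b / x) = a / x" if "b > 0" for a b :: real using that by simp
    from this[OF pos] show ?case unfolding eq .
  qed
  ultimately show ?thesis unfolding has_asymptotic_density_def by (rule Lim_transform_eventually)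
qed

text \<open>From some \<open>k\<close> on, \<open>\<xi> n\<close> is at least \<open>ln M\<close>.
  The excess over \<open>iter_ln 3 n - ln M\<close> has density \<open>1 - exp (- M)\<close>, by the
  case \<open>c = 1 / M\<close>, and the excess over \<open>iter_ln 3 n + ln M\<close> has density
  \<open>1 - exp (- (1 / M))\<close>, by the case \<open>c = M\<close>; their difference tends to 1
  as \<open>M\<close> grows.\<close>

lemma near_iter_ln_density_nat:
  fixes \<xi> :: "nat \<Rightarrow> real"
  assumes \<xi>: "filterlim \<xi> at_top sequentially"
  shows "(\<lambda>N. card {n\<in>{1..N}. iter_ln 3 n - \<xi> n \<le> max_log_gap n \<and> max_log_gap n \<le> iter_ln 3 n + \<xi> n} / N)
           \<longlonglongrightarrow> 1" (is "(\<lambda>N. card (?S N) / N) \<longlonglongrightarrow> 1")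
proof (rule order_tendstoI)
  fix a :: real assume "a > 1"
  have "card (?S N) / N \<le> 1" for N
  proof -
    have "card (?S N) \<le> card {1..N}" by (intro card_mono) auto
    then show ?thesis by (cases "N = 0") (auto simp: divide_le_eq_1)
  qed
  then have "card (?S N) / N < a" for N using \<open>a > 1\<close> by (rule order_le_less_trans)
  then show "eventually (\<lambda>N. card (?S N) / N < a) sequentially" by simp
next
  fix a :: real assume a: "a < 1"
  have "((\<lambda>x::real. exp (- (1 / x)) - exp (- x)) \<longlongrightarrow> 1) at_top" by real_asymp
  then have "eventually (\<lambda>x::real. a < exp (- (1 / x)) - exp (- x)) at_top"
    using a by (rule order_tendstoD)
  then have "eventually (\<lambda>x::real. a < exp (- (1 / x)) - exp (- x) \<and> x > 0) at_top"
    using eventually_gt_at_top[of 0] by (rule eventually_conj)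
  then obtain M :: real where M: "a < exp (- (1 / M)) - exp (- M)" "M > 0"
    by (auto simp: eventually_at_top_linorder)
  obtain k where k: "\<And>n. n \<ge> k \<Longrightarrow> ln M \<le> \<xi> n"
    using \<xi> unfolding filterlim_at_top eventually_sequentially by blast
  define A where "A = (\<lambda>c N. {n\<in>{1..N}. max_log_gap n > iter_ln 3 n - ln (1 / c)})"
  have "(\<lambda>N. card (A (1 / M) N) / N - card (A M N) / N - k / N)
      \<longlonglongrightarrow> (1 - exp (- (1 / (1 / M)))) - (1 - exp (- (1 / M))) - 0"
    unfolding A_def
    by (intro tendsto_diff exceeds_density_nat tendsto_divide_0[OF tendsto_const] filterlim_at_top_imp_at_infinity filterlim_real_sequentially)
       (use M in auto)
  then have "eventually (\<lambda>N. a < card (A (1 / M) N) / N - card (A M N) / N - k / N) sequentially"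
    using M by (intro order_tendstoD(1)) auto
  then show "eventually (\<lambda>N. a < card (?S N) / N) sequentially"
  proof eventually_elim
    case (elim N)
    have "A (1 / M) N \<subseteq> ?S N \<union> A M N \<union> {..<k}"
    proof
      fix n assume n: "n \<in> A (1 / M) N"
      show "n \<in> ?S N \<union> A M N \<union> {..<k}"
        using n k[of n] M by (cases "n < k") (auto simp: A_def ln_div)
    qed
    then have "card (A (1 / M) N) \<le> card (?S N \<union> A M N \<union> {..<k})"
      by (intro card_mono) (auto simp: A_def)
    also have "\<dots> \<le> card (?S N) + card (A M N) + card {..<k}"
      by (meson add_mono_thms_linordered_semiring(3) card_Un_le order_trans)
    finally have "real (card (A (1 / M) N)) \<le> real (card (?S N)) + real (card (A M N)) + real k" by simp
    then have "real (card (A (1 / M) N)) / N \<le> (real (card (?S N)) + real (card (A M N)) + real k) / N"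
      by (intro divide_right_mono) auto
    with elim show ?case by (simp add: add_divide_distrib)
  qed
qed

theorem theorem1:
  shows "(\<forall>c::real. c > 0 \<longrightarrow>
            has_asymptotic_density
              {n::nat. n > 0 \<and> max_log_gap n > iter_ln 3 (real n) - ln (1 / c)}
              (1 - exp (- (1 / c)))) \<and>
         (\<forall>\<xi> :: nat \<Rightarrow> real. filterlim \<xi> at_top sequentially \<longrightarrow>
            has_asymptotic_density
              {n::nat. n > 0 \<and> iter_ln 3 (real n) - \<xi> n \<le> max_log_gap n \<and>
                       max_log_gap n \<le> iter_ln 3 (real n) + \<xi> n}
              1)"
proof (intro conjI allI impI has_asymptotic_densityI)
  fix c :: real assume "c > 0"
  have "{n\<in>{1..N}. n \<in> {n. n > 0 \<and> max_log_gap n > iter_ln 3 n - ln (1 / c)}}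
      = {n\<in>{1..N}. max_log_gap n > iter_ln 3 n - ln (1 / c)}" for N by auto
  then show "(\<lambda>N. card {n\<in>{1..N}. n \<in> {n. n > 0 \<and> max_log_gap n > iter_ln 3 n - ln (1 / c)}} / N)
      \<longlonglongrightarrow> 1 - exp (- (1 / c))"
    using exceeds_density_nat[OF \<open>c > 0\<close>] by simp
next
  fix \<xi> :: "nat \<Rightarrow> real" assume \<xi>: "filterlim \<xi> at_top sequentially"
  have "{n\<in>{1..N}. n \<in> {n. n > 0 \<and> iter_ln 3 n - \<xi> n \<le> max_log_gap n \<and> max_log_gap n \<le> iter_ln 3 n + \<xi> n}}
      = {n\<in>{1..N}. iter_ln 3 n - \<xi> n \<le> max_log_gap n \<and> max_log_gap n \<le> iter_ln 3 n + \<xi> n}" for N by auto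
  then show "(\<lambda>N. card {n\<in>{1..N}. n \<in> {n. n > 0 \<and> iter_ln 3 n - \<xi> n \<le> max_log_gap n \<and> max_log_gap n \<le> iter_ln 3 n + \<xi> n}} / N)
      \<longlonglongrightarrow> 1"
    using near_iter_ln_density_nat[OF \<xi>] by simp
qed

end
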